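(* The Maclaurin series $$\sum_{k=0}^\infty r_{5,k}\,x^{2k+1}$$ converges uniformly to a continuous function for $x\in[-3,3]$, and agrees with $p_5(x)$ for $x\in[0,1]$.
   Context: $J_0$ is the Bessel function of the first kind of order zero; $I_0(t)=\frac1\pi\int_0^\pi e^{t\cos\theta}\,d\theta$ and $K_0(t)=\int_0^\infty e^{-t\cosh u}\,du$ ($t>0$) are the modified Bessel functions of order zero. Kluyver's 5-step density for planar uniform random walks is $p_5(x)=\int_0^\infty J_0(xt)[J_0(t)]^5\,xt\,dt$. The numbers $r_{5,k}$, $k\in\mathbb Z_{\ge0}$, are the Taylor coefficients of $p_5$ at $0^+$ (that is, $p_5(x)=\sum_{k\ge0}r_{5,k}x^{2k+1}$ for small positive $x$), given explicitly by $$r_{5,k}=\frac{30}{4^{k}(k!)^2\pi^4}\int_0^\infty I_{0}(t)[K_0(t)]^4 t^{2k+1}\,dt .$$ *)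

theory Defs
  imports "HOL-Analysis.Analysis"
begin

definition bessel_J0 :: "real \<Rightarrow> real" where
  "bessel_J0 t = (\<Sum>m. (- 1) ^ m / (fact m)\<^sup>2 * (t / 2) ^ (2 * m))"

definition bessel_I0 :: "real \<Rightarrow> real" where
  "bessel_I0 t = 1 / pi * (LBINT \<theta>:{0..pi}. exp (t * cos \<theta>))"

(* Only meaningful for t > 0; the integrand is not integrable for t <= 0. *)
definition bessel_K0 :: "real \<Rightarrow> real" where
  "bessel_K0 t = (LBINT u:{0..}. exp (- t * cosh u))"

(* For x >= 0 the integral converges absolutely: bessel_J0 t = O(t powr (-1/2)),
   so for x > 0 the integrand is O(t powr (-2)), and for x = 0 it vanishes. *)
definition kluyver_p5 :: "real \<Rightarrow> real" where
  "kluyver_p5 x = (LBINT t:{0..}. bessel_J0 (x * t) * bessel_J0 t ^ 5 * x * t)"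

definition r5 :: "nat \<Rightarrow> real" where
  "r5 k = 30 / (4 ^ k * (fact k)\<^sup>2 * pi ^ 4) *
     (LBINT t:{0<..}. bessel_I0 t * bessel_K0 t ^ 4 * t ^ (2 * k + 1))"

end

theory Submission
  imports Defs "HOL-Complex_Analysis.Complex_Analysis" "HOL-Real_Asymp.Real_Asymp"
    "HOL-Probability.Sinc_Integral"
begin

text \<open>
The link between the density and the series is the formula
\[ p_5(x) = \frac{30}{\pi^4} \int_0^\infty x t I_0(xt) I_0(t) K_0(t)^4 dt  \qquad (0 < x \le 1), \]
proved by rotating a ray of integration by a quarter turn.

Let \<open>cI0\<close> be the entire extension of \<open>I\<^sub>0\<close> and \<open>cK0\<close> the
holomorphic extension of \<open>K\<^sub>0\<close> to a half-plane that contains the positive imaginary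
axis. Then \<open>cI0 (\<i> t) = J\<^sub>0(t)\<close>, and \<open>H = (2\<i>/\<pi>) cK0\<close> takes at
\<open>\<i> t\<close> a value with real part \<open>J\<^sub>0(t)\<close> (lemma \<open>Im_cK0_ii\<close>; the value
is the Hankel function \<open>J\<^sub>0 - \<i> Y\<^sub>0\<close>). Whenever
\<open>J = Re H\<close>, the polynomial
\<open>20 J\<^sup>2 H\<^sup>3 + 3 H\<^sup>5 - 15 J H\<^sup>4\<close> has real part \<open>8 J\<^sup>5\<close>
(lemma \<open>Re_fifth_power_combination\<close>). Hence the integrand of \<open>p\<^sub>5\<close> comes from the
restriction of the holomorphic function
\[ w \, cI0(xw) (20 \, cI0(w)^2 H(w)^3 + 3 H(w)^5 - 15 \, cI0(w) H(w)^4) / 8 \]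
to the imaginary axis. In the first quadrant \<open>cI0\<close> is of size
\<open>exp (Re w) |w|\<^sup>-\<^sup>1\<^sup>/\<^sup>2\<close> and \<open>cK0\<close> of size
\<open>exp (- Re w) |w|\<^sup>-\<^sup>1\<^sup>/\<^sup>2\<close>. For \<open>x \<le> 1\<close> the exponentials
never win, \<open>w\<close> and the six Bessel factors leave \<open>|w|\<^sup>-\<^sup>2\<close>, and the ray may be rotated to the
positive real axis (lemma \<open>wick_rotation\<close>). There \<open>H\<close> is imaginary, so only the
term with \<open>H\<^sup>4\<close> survives in the real part.

The integrand \<open>x t I\<^sub>0(xt) I\<^sub>0(t) K\<^sub>0(t)\<^sup>4\<close> is integrable for all
\<open>x \<le> 3\<close>: at \<open>x = 3\<close> the exponentials cancel and the decay
\<open>t\<^sup>-\<^sup>2\<close> remains. Expanding \<open>I\<^sub>0(xt)\<close> gives, term by term, the series with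
coefficients \<open>r5 k\<close>. Since these are nonnegative, convergence at \<open>x = 3\<close> is all that
the Weierstrass test needs on \<open>[-3, 3]\<close>.
\<close>

section \<open>Integration on the line\<close>

lemma set_integrable_interval:
  fixes f :: "real \<Rightarrow> 'a::euclidean_space"
  assumes "continuous_on {a..b} f"
  shows "set_integrable lborel {a..b} f"
  using assms borel_integrable_compact[of "{a..b}" f] by (simp add: set_integrable_def indicator_scaleR_eq_if if_distrib cong: if_cong)

lemma LBINT_eqI:
  fixes f :: "real \<Rightarrow> 'a::euclidean_space"
  assumes "continuous_on {a..b} f" "(f has_integral I) {a..b}"
  shows "(LBINT x:{a..b}. f x) = I"
  using set_borel_integral_eq_integral[OF set_integrable_interval[OF assms(1)]] assms(2) by auto

lemma set_integrable_dominated: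
  fixes f :: "real \<Rightarrow> 'a::{banach, second_countable_topology}" and h :: "real \<Rightarrow> real"
  assumes A: "A \<in> sets borel" and f: "continuous_on A f"
    and h: "set_integrable lborel A h" and le: "\<And>x. x \<in> A \<Longrightarrow> norm (f x) \<le> h x"
  shows set_integrable_dominatedI: "set_integrable lborel A f"
    and set_integral_dominated_le: "norm (LBINT x:A. f x) \<le> (LBINT x:A. h x)"
proof -
  show int: "set_integrable lborel A f"
  proof (rule set_integrable_bound[OF h])
    show "set_borel_measurable lborel A f"
      unfolding set_borel_measurable_def
      using borel_measurable_continuous_on_indicator[OF A f] by simp
    show "AE x in lborel. x \<in> A \<longrightarrow> norm (f x) \<le> norm (h x)"
      using le by (intro AE_I2) (auto intro: order_trans[OF _ abs_ge_self])
  qed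
  show "norm (LBINT x:A. f x) \<le> (LBINT x:A. h x)"
    using set_integral_norm_bound[OF int] set_integral_mono[OF set_integrable_norm[OF int] h le] by simp
qed

lemma LBINT_atLeast_eq_greaterThan:
  fixes f :: "real \<Rightarrow> 'a::{banach, second_countable_topology}"
  shows "(LBINT x:{a..}. f x) = (LBINT x:{a<..}. f x)"
  by (rule set_integral_discrete_difference[where X = "{a}"]) auto

lemma set_integrable_atLeast_iff_greaterThan:
  fixes f :: "real \<Rightarrow> 'a::{banach, second_countable_topology}"
  shows "set_integrable lborel {a..} f \<longleftrightarrow> set_integrable lborel {a<..} f"
  by (rule set_integrable_discrete_difference[where X = "{a}"]) auto

lemma set_integral_Re:
  assumes "set_integrable M A (f :: _ \<Rightarrow> complex)"
  shows set_integrable_Re: "set_integrable M A (\<lambda>t. Re (f t))"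
    and LINT_Re: "(LINT t:A|M. Re (f t)) = Re (LINT t:A|M. f t)"
  using assms integrable_Re[of M "\<lambda>t. indicator A t *\<^sub>R f t"] integral_Re[of M "\<lambda>t. indicator A t *\<^sub>R f t"]
  by (simp_all add: set_integrable_def set_lebesgue_integral_def)

section \<open>Holomorphic dependence on a parameter\<close>

text \<open>The usual criterion for holomorphic dependence on a parameter. Only the integrand itself has to be
dominated: Cauchy's inequality on a ball a third as large turns the bound \<open>h\<close> on the
integrand into the bound \<open>3 / r * h\<close> on its derivative, hence on its difference
quotients, and dominated convergence applies to these.\<close>

lemma holomorphic_on_integral:
  fixes g :: "complex \<Rightarrow> 'a \<Rightarrow> complex"
  assumes S: "open S"
    and meas: "\<And>z. z \<in> S \<Longrightarrow> g z \<in> borel_measurable M"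
    and hol: "\<And>v. v \<in> space M \<Longrightarrow> (\<lambda>z. g z v) holomorphic_on S"
    and dom: "\<And>z. z \<in> S \<Longrightarrow> \<exists>r>0. \<exists>h. ball z r \<subseteq> S \<and> integrable M h \<and>
                (\<forall>w\<in>ball z r. \<forall>v\<in>space M. norm (g w v) \<le> h v)"
  shows "(\<lambda>z. integral\<^sup>L M (g z)) holomorphic_on S"
proof -
  have "(\<lambda>z. integral\<^sup>L M (g z)) field_differentiable (at z)" if "z \<in> S" for z
  proof -
    from dom[OF that] obtain r and h :: "'a \<Rightarrow> real" where r: "r > 0" "ball z r \<subseteq> S"
      and h: "integrable M h" and gh: "\<And>w v. w \<in> ball z r \<Longrightarrow> v \<in> space M \<Longrightarrow> norm (g w v) \<le> h v"
      by blast
    define B where "B = ball z (r/3)"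
    have zB: "z \<in> B" using r by (simp add: B_def)
    have Br: "B \<subseteq> ball z r" using r by (auto simp: B_def)
    have der: "((\<lambda>w. g w v) has_field_derivative deriv (\<lambda>w. g w v) w) (at w)"
      if "w \<in> ball z r" "v \<in> space M" for w v
      using hol[OF that(2)] holomorphic_derivI[OF _ S] that r by blast
    have bd: "norm (deriv (\<lambda>w. g w v) w) \<le> 3 / r * h v" if w: "w \<in> B" and v: "v \<in> space M" for w v
    proof -
      have sub: "cball w (r/3) \<subseteq> ball z r"
      proof
        fix x assume "x \<in> cball w (r/3)"
        with w have "dist z w < r/3" "dist w x \<le> r/3" by (auto simp: B_def)
        then show "x \<in> ball z r" using dist_triangle[of z x w] r by simp
      qed
      have holw: "(\<lambda>w. g w v) holomorphic_on cball w (r/3)"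
        using hol[OF v] holomorphic_on_subset sub r by blast
      have "norm ((deriv ^^ 1) (\<lambda>w. g w v) w) \<le> fact 1 * h v / (r/3) ^ 1"
      proof (rule Cauchy_inequality)
        show "(\<lambda>w. g w v) holomorphic_on ball w (r/3)"
          using holw holomorphic_on_subset ball_subset_cball by blast
        show "continuous_on (cball w (r/3)) (\<lambda>w. g w v)"
          using holw by (rule holomorphic_on_imp_continuous_on)
        fix x assume "norm (w - x) = r/3"
        then have "x \<in> cball w (r/3)" by (simp add: dist_norm)
        then show "norm (g x v) \<le> h v" using sub gh v by blast
      qed (use r in auto)
      then show ?thesis by (simp add: field_simps)
    qed
    have int: "integrable M (g w)" if "w \<in> B" for w
    proof (rule Bochner_Integration.integrable_bound[OF h])
      show "g w \<in> borel_measurable M" using meas that Br r by blast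
      show "AE v in M. norm (g w v) \<le> norm (h v)"
        using gh[of w] that Br by (intro AE_I2) (auto intro!: order_trans[OF _ abs_ge_self])
    qed
    have quot: "norm ((g w v - g z v) / (w - z)) \<le> 3 / r * h v"
      if w: "w \<in> B" "w \<noteq> z" and v: "v \<in> space M" for w v
    proof -
      have "norm (g w v - g z v) \<le> (3 / r * h v) * norm (w - z)"
      proof (rule field_differentiable_bound[of B])
        show "convex B" by (simp add: B_def)
        show "\<And>x. x \<in> B \<Longrightarrow> ((\<lambda>w. g w v) has_field_derivative deriv (\<lambda>w. g w v) x) (at x within B)"
          using der v Br by (blast intro: has_field_derivative_at_within)
      qed (use bd v w zB in auto)
      moreover have "0 < norm (w - z)" using w by simp
      ultimately show ?thesis by (simp add: norm_divide pos_divide_le_eq)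
    qed
    have "((\<lambda>w. (integral\<^sup>L M (g w) - integral\<^sup>L M (g z)) / (w - z))
             \<longlongrightarrow> integral\<^sup>L M (\<lambda>v. deriv (\<lambda>w. g w v) z)) (at z within B)"
      unfolding tendsto_at_iff_sequentially
    proof (intro allI impI)
      fix X :: "nat \<Rightarrow> complex" assume X: "\<forall>i. X i \<in> B - {z}" "X \<longlonglongrightarrow> z"
      have lim: "(\<lambda>n. (g (X n) v - g z v) / (X n - z)) \<longlonglongrightarrow> deriv (\<lambda>w. g w v) z" if "v \<in> space M" for v
      proof -
        have "((\<lambda>w. (g w v - g z v) / (w - z)) \<longlongrightarrow> deriv (\<lambda>w. g w v) z) (at z within B)"
          using has_field_derivative_at_within[OF der[OF _ that]] r
          unfolding has_field_derivative_iff by simp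
        then show ?thesis
          using X unfolding tendsto_at_iff_sequentially o_def by blast
      qed
      have mX: "(\<lambda>v. (g (X n) v - g z v) / (X n - z)) \<in> borel_measurable M" for n
      proof -
        have "X n \<in> S" using X Br r by blast
        then show ?thesis using meas that by measurable
      qed
      have "(\<lambda>n. \<integral>v. (g (X n) v - g z v) / (X n - z) \<partial>M) \<longlonglongrightarrow> integral\<^sup>L M (\<lambda>v. deriv (\<lambda>w. g w v) z)"
      proof (rule integral_dominated_convergence[where w = "\<lambda>v. 3 / r * h v"])
        show "(\<lambda>v. deriv (\<lambda>w. g w v) z) \<in> borel_measurable M"
          by (rule borel_measurable_LIMSEQ_metric[OF mX lim])
        show "integrable M (\<lambda>v. 3 / r * h v)" using h by simp
        show "AE v in M. norm ((g (X n) v - g z v) / (X n - z)) \<le> 3 / r * h v" for n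
          using quot X by (intro AE_I2) blast
      qed (use lim mX in auto)
      moreover have "(\<integral>v. (g (X n) v - g z v) / (X n - z) \<partial>M)
          = (integral\<^sup>L M (g (X n)) - integral\<^sup>L M (g z)) / (X n - z)" for n
      proof -
        have "integrable M (g (X n))" using X by (intro int) blast
        with int[OF zB] show ?thesis by simp
      qed
      ultimately show "((\<lambda>w. (integral\<^sup>L M (g w) - integral\<^sup>L M (g z)) / (w - z)) \<circ> X)
          \<longlonglongrightarrow> integral\<^sup>L M (\<lambda>v. deriv (\<lambda>w. g w v) z)"
        by (simp only: o_def)
    qed
    moreover have "at z within B = at z"
      using zB by (intro at_within_open) (auto simp: B_def)
    ultimately show ?thesis
      unfolding field_differentiable_def has_field_derivative_iff by metis
  qed
  then show ?thesis
    using S by (simp add: holomorphic_on_def field_differentiable_at_within)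
qed

lemma holomorphic_on_set_integral:
  fixes g :: "complex \<Rightarrow> real \<Rightarrow> complex"
  assumes S: "open S"
    and meas: "\<And>z. z \<in> S \<Longrightarrow> set_borel_measurable lborel A (g z)"
    and hol: "\<And>v. v \<in> A \<Longrightarrow> (\<lambda>z. g z v) holomorphic_on S"
    and dom: "\<And>z. z \<in> S \<Longrightarrow> \<exists>r>0. \<exists>h. ball z r \<subseteq> S \<and> set_integrable lborel A h \<and>
                (\<forall>w\<in>ball z r. \<forall>v\<in>A. norm (g w v) \<le> h v)"
  shows "(\<lambda>z. LBINT v:A. g z v) holomorphic_on S"
  unfolding set_lebesgue_integral_def
proof (rule holomorphic_on_integral[OF S])
  show "(\<lambda>v. indicator A v *\<^sub>R g z v) \<in> borel_measurable lborel" if "z \<in> S" for z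
    using meas[OF that] by (simp add: set_borel_measurable_def)
  show "(\<lambda>z. indicator A v *\<^sub>R g z v) holomorphic_on S" for v
    using hol by (cases "v \<in> A") auto
  fix z assume "z \<in> S"
  from dom[OF this] obtain r and h :: "real \<Rightarrow> real" where "r > 0" "ball z r \<subseteq> S"
    "set_integrable lborel A h" "\<And>w v. w \<in> ball z r \<Longrightarrow> v \<in> A \<Longrightarrow> norm (g w v) \<le> h v"
    by blast
  then show "\<exists>r>0. \<exists>h. ball z r \<subseteq> S \<and> integrable lborel h \<and>
      (\<forall>w\<in>ball z r. \<forall>v\<in>space lborel. norm (indicator A v *\<^sub>R g w v) \<le> h v)"
    by (intro exI[of _ r] conjI exI[of _ "\<lambda>v. indicator A v *\<^sub>R h v"])
       (auto simp: set_integrable_def split: split_indicator)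
qed

section \<open>Rotation of a ray of integration by a quarter turn\<close>

lemma LBINT_primitive_on_line:
  fixes F f :: "complex \<Rightarrow> complex"
  assumes "a \<le> b" and S: "\<And>t. t \<in> {a..b} \<Longrightarrow> c + d * of_real t \<in> S"
    and F: "\<And>z. z \<in> S \<Longrightarrow> (F has_field_derivative f z) (at z)"
    and f: "continuous_on S f"
  shows "(LBINT t:{a..b}. d * f (c + d * of_real t)) = F (c + d * of_real b) - F (c + d * of_real a)"
proof (rule LBINT_eqI)
  show "continuous_on {a..b} (\<lambda>t. d * f (c + d * of_real t))"
    using S by (intro continuous_intros continuous_on_compose2[OF f]) auto
  show "((\<lambda>t. d * f (c + d * of_real t)) has_integral (F (c + d * of_real b) - F (c + d * of_real a))) {a..b}"
  proof (rule fundamental_theorem_of_calculus[OF \<open>a \<le> b\<close>])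
    fix t assume t: "t \<in> {a..b}"
    have "((\<lambda>t. c + d * of_real t) has_vector_derivative 0 + d * of_real 1) (at t within {a..b})"
      by (intro has_vector_derivative_add has_vector_derivative_const has_vector_derivative_mult_right
            has_vector_derivative_of_real DERIV_ident)
    then have p: "((\<lambda>t. c + d * of_real t) has_vector_derivative d) (at t within {a..b})" by simp
    from field_vector_diff_chain_within[OF p has_field_derivative_at_within[OF F[OF S[OF t]]]]
    show "((\<lambda>t. F (c + d * of_real t)) has_vector_derivative d * f (c + d * of_real t)) (at t within {a..b})"
      by (simp only: o_def)
  qed
qed

lemma add_pos_notin_nonpos_Reals:
  assumes "Re w + Im w > 0"
  shows "w \<notin> \<real>\<^sub>\<le>\<^sub>0"
  using assms by (auto simp: complex_nonpos_Reals_iff)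

text \<open>This half-plane contains the closed first quadrant without the origin, boundary rays included, and
it is convex. Convexity provides primitives and the identity theorem without any discussion of
simple connectedness.\<close>

abbreviation halfplane :: "complex set" where
  "halfplane \<equiv> {w. Re w + Im w > 0}"

lemma open_halfplane: "open halfplane"
  by (intro open_Collect_less continuous_intros)

lemma convex_halfplane: "convex halfplane"
proof -
  have "halfplane = {w. Complex 1 1 \<bullet> w > 0}" by (auto simp: inner_complex_def)
  then show ?thesis by (simp add: convex_halfspace_gt)
qed

text \<open>With a primitive \<open>F\<close> of \<open>P\<close>, the two integrals over
\<open>[1/n, n]\<close> differ by the increments of \<open>F\<close> along two quarter circles.
Along the circle of radius \<open>r\<close> the increment is at most
\<open>C r / (1 + r\<^sup>2)\<close> times \<open>\<pi>/2\<close>, which vanishes both for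
\<open>r \<rightarrow> 0\<close> and for \<open>r \<rightarrow> \<infinity>\<close>.\<close>

lemma wick_rotation:
  assumes hol: "P holomorphic_on halfplane"
    and bound: "\<And>w. Re w \<ge> 0 \<Longrightarrow> Im w \<ge> 0 \<Longrightarrow> w \<noteq> 0 \<Longrightarrow> norm (P w) \<le> C / (1 + (norm w)\<^sup>2)"
  shows "set_integrable lborel {0<..} (\<lambda>t. P (of_real t))"
    and "set_integrable lborel {0<..} (\<lambda>t. P (\<i> * of_real t))"
    and "(LBINT t:{0<..}. P (of_real t)) = (LBINT t:{0<..}. \<i> * P (\<i> * of_real t))"
proof -
  have cP: "continuous_on halfplane P" using hol by (rule holomorphic_on_imp_continuous_on)
  have dom: "set_integrable lborel {0<..} (\<lambda>t::real. C * inverse (1 + t\<^sup>2))"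
    using integrable_inverse_1_plus_square
    by (intro set_integrable_mult_right) (auto intro: set_integrable_subset)
  show int1: "set_integrable lborel {0<..} (\<lambda>t. P (of_real t))"
  proof (rule set_integrable_dominatedI[OF _ _ dom])
    show "continuous_on {0<..} (\<lambda>t. P (of_real t))"
      by (intro continuous_on_compose2[OF cP] continuous_intros) auto
    show "norm (P (of_real t)) \<le> C * inverse (1 + t\<^sup>2)" if "t \<in> {0<..}" for t
      using bound[of "of_real t"] that by (simp add: divide_inverse)
  qed simp
  show int2: "set_integrable lborel {0<..} (\<lambda>t. P (\<i> * of_real t))"
  proof (rule set_integrable_dominatedI[OF _ _ dom])
    show "continuous_on {0<..} (\<lambda>t. P (\<i> * of_real t))"
      by (intro continuous_on_compose2[OF cP] continuous_intros) auto
    show "norm (P (\<i> * of_real t)) \<le> C * inverse (1 + t\<^sup>2)" if "t \<in> {0<..}" for t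
      using bound[of "\<i> * of_real t"] that by (simp add: divide_inverse norm_mult)
  qed simp
  obtain F where F': "\<And>z. z \<in> halfplane \<Longrightarrow> (F has_field_derivative P z) (at z within halfplane)"
    using holomorphic_convex_primitive'[OF convex_halfplane open_halfplane hol] by blast
  have F: "(F has_field_derivative P z) (at z)" if "z \<in> halfplane" for z
    using F'[OF that] at_within_open[OF that open_halfplane] by simp
  have C0: "C \<ge> 0"
    using order_trans[OF norm_ge_zero bound[of 1]] by simp
  have arc: "norm (F (\<i> * of_real r) - F (of_real r)) \<le> C * r / (1 + r\<^sup>2) * (pi / 2)" if r: "r > 0" for r
  proof -
    have on_arc: "Re (of_real r * exp (\<i> * of_real \<theta>)) \<ge> 0 \<and> Im (of_real r * exp (\<i> * of_real \<theta>)) \<ge> 0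
        \<and> of_real r * exp (\<i> * of_real \<theta>) \<in> halfplane" if "\<theta> \<in> {0..pi/2}" for \<theta>
    proof -
      have "cos \<theta> \<ge> 0" "sin \<theta> \<ge> 0" using that by (auto intro!: cos_ge_zero sin_ge_zero)
      moreover have "\<not> (cos \<theta> = 0 \<and> sin \<theta> = 0)" using sin_zero_abs_cos_one[of \<theta>] by auto
      ultimately have "cos \<theta> + sin \<theta> > 0" by linarith
      then have "0 < r * (cos \<theta> + sin \<theta>)" using r by simp
      then show ?thesis using \<open>cos \<theta> \<ge> 0\<close> \<open>sin \<theta> \<ge> 0\<close> r by (simp add: Re_exp Im_exp ring_distribs)
    qed
    have "((\<lambda>\<theta>. \<i> * (of_real r * exp (\<i> * of_real \<theta>)) * P (of_real r * exp (\<i> * of_real \<theta>)))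
        has_integral (F (of_real r * exp (\<i> * of_real (pi/2))) - F (of_real r * exp (\<i> * of_real 0)))) {0..pi/2}"
    proof (rule fundamental_theorem_of_calculus)
      fix \<theta> assume \<theta>: "\<theta> \<in> {0..pi/2}"
      have "((\<lambda>z. of_real r * exp (\<i> * z)) has_field_derivative \<i> * (of_real r * exp (\<i> * of_real \<theta>)))
          (at (of_real \<theta>) within of_real ` {0..pi/2})"
        by (auto intro!: derivative_eq_intros)
      from field_vector_diff_chain_within[OF has_vector_derivative_of_real[OF DERIV_ident] this]
      have p: "((\<lambda>\<theta>. of_real r * exp (\<i> * of_real \<theta>)) has_vector_derivative \<i> * (of_real r * exp (\<i> * of_real \<theta>)))
          (at \<theta> within {0..pi/2})" by (simp add: o_def)
      have "(F has_field_derivative P (of_real r * exp (\<i> * of_real \<theta>)))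
          (at (of_real r * exp (\<i> * of_real \<theta>)) within (\<lambda>\<theta>. of_real r * exp (\<i> * of_real \<theta>)) ` {0..pi/2})"
        by (rule has_field_derivative_at_within[OF F[OF conjunct2[OF conjunct2[OF on_arc[OF \<theta>]]]]])
      from field_vector_diff_chain_within[OF p this]
      show "((\<lambda>\<theta>. F (of_real r * exp (\<i> * of_real \<theta>))) has_vector_derivative
          \<i> * (of_real r * exp (\<i> * of_real \<theta>)) * P (of_real r * exp (\<i> * of_real \<theta>))) (at \<theta> within {0..pi/2})"
        by (simp only: o_def)
    qed simp
    moreover have "of_real r * exp (\<i> * of_real (pi/2)) = \<i> * of_real r"
      using exp_Euler[of "of_real (pi/2)"] by (simp only: cos_of_real sin_of_real cos_pi_half sin_pi_half) simp
    moreover have "of_real r * exp (\<i> * of_real 0) = complex_of_real r" by simp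
    ultimately have int: "((\<lambda>\<theta>. \<i> * (of_real r * exp (\<i> * of_real \<theta>)) * P (of_real r * exp (\<i> * of_real \<theta>)))
        has_integral (F (\<i> * of_real r) - F (of_real r))) {0..pi/2}"
      by (simp only:)
    have "norm (F (\<i> * of_real r) - F (of_real r)) \<le> C * r / (1 + r\<^sup>2) * measure lborel {0..pi/2}"
    proof (rule has_integral_bound_real[OF _ finite.emptyI int])
      show "0 \<le> C * r / (1 + r\<^sup>2)" using C0 r by simp
      fix \<theta> assume "\<theta> \<in> {0..pi/2} - {}"
      then have \<theta>: "\<theta> \<in> {0..pi/2}" by simp
      have "norm (P (of_real r * exp (\<i> * of_real \<theta>))) \<le> C / (1 + (norm (of_real r * exp (\<i> * of_real \<theta>)))\<^sup>2)"
        using on_arc[OF \<theta>] r by (intro bound) auto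
      then have "norm (P (of_real r * exp (\<i> * of_real \<theta>))) \<le> C / (1 + r\<^sup>2)"
        by (simp add: norm_mult)
      then have "r * norm (P (of_real r * exp (\<i> * of_real \<theta>))) \<le> r * (C / (1 + r\<^sup>2))"
        using r by (intro mult_left_mono) auto
      then show "norm (\<i> * (of_real r * exp (\<i> * of_real \<theta>)) * P (of_real r * exp (\<i> * of_real \<theta>))) \<le> C * r / (1 + r\<^sup>2)"
        using r by (simp add: norm_mult mult_ac)
    qed
    then show ?thesis by simp
  qed
  define A where "A n = {1 / real (Suc n)..real (Suc n)}" for n
  have A_pos: "t > 0" if "t \<in> A n" for t n
    using that by (auto simp: A_def intro: less_le_trans[rotated])
  have A_le: "1 / real (Suc n) \<le> real (Suc n)" for n
    by (rule order_trans[of _ 1]) simp_all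
  have incA: "incseq A"
    unfolding A_def by (intro incseq_SucI) (auto simp: field_simps)
  have UN: "(\<Union>n. A n) = {0<..}"
  proof
    show "{0<..} \<subseteq> (\<Union>n. A n)"
    proof
      fix t :: real assume "t \<in> {0<..}"
      then have t: "t > 0" by simp
      obtain n where n: "max t (1 / t) < real n" using reals_Archimedean2 by blast
      have "1 / real (Suc n) \<le> t"
      proof -
        have "1 / t \<le> real (Suc n)" using n by simp
        then show ?thesis using t by (simp add: field_simps)
      qed
      then show "t \<in> (\<Union>n. A n)" using n by (auto simp: A_def intro!: exI[of _ n])
    qed
  qed (use A_pos in auto)
  have i1: "(LBINT t:A n. P (of_real t)) = F (of_real (real (Suc n))) - F (of_real (1 / real (Suc n)))" for n
    using LBINT_primitive_on_line[OF A_le[of n], of 0 1 halfplane F P] F cP A_pos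
    unfolding A_def by simp
  have i2: "(LBINT t:A n. \<i> * P (\<i> * of_real t)) = F (\<i> * of_real (real (Suc n))) - F (\<i> * of_real (1 / real (Suc n)))" for n
    using LBINT_primitive_on_line[OF A_le[of n], of 0 \<i> halfplane F P] F cP A_pos
    unfolding A_def by simp
  have meas: "A n \<in> sets lborel" for n by (simp add: A_def)
  have int2': "set_integrable lborel {0<..} (\<lambda>t. \<i> * P (\<i> * of_real t))" using int2 by simp
  have lim1: "(\<lambda>n. LBINT t:A n. P (of_real t)) \<longlonglongrightarrow> (LBINT t:{0<..}. P (of_real t))"
    using set_integral_cont_up[OF meas incA, of "\<lambda>t. P (of_real t)"] int1 unfolding UN by simp
  have lim2: "(\<lambda>n. LBINT t:A n. \<i> * P (\<i> * of_real t)) \<longlonglongrightarrow> (LBINT t:{0<..}. \<i> * P (\<i> * of_real t))"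
    using set_integral_cont_up[OF meas incA, of "\<lambda>t. \<i> * P (\<i> * of_real t)"] int2' unfolding UN by blast
  have z1: "(\<lambda>n. F (\<i> * of_real (real (Suc n))) - F (of_real (real (Suc n)))) \<longlonglongrightarrow> 0"
  proof (rule Lim_null_comparison)
    show "\<forall>\<^sub>F n in sequentially. norm (F (\<i> * of_real (real (Suc n))) - F (of_real (real (Suc n))))
        \<le> C * real (Suc n) / (1 + (real (Suc n))\<^sup>2) * (pi / 2)"
      by (intro always_eventually allI arc) simp
    show "(\<lambda>n. C * real (Suc n) / (1 + (real (Suc n))\<^sup>2) * (pi / 2)) \<longlonglongrightarrow> 0" by real_asymp
  qed
  have z2: "(\<lambda>n. F (\<i> * of_real (1 / real (Suc n))) - F (of_real (1 / real (Suc n)))) \<longlonglongrightarrow> 0"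
  proof (rule Lim_null_comparison)
    show "\<forall>\<^sub>F n in sequentially. norm (F (\<i> * of_real (1 / real (Suc n))) - F (of_real (1 / real (Suc n))))
        \<le> C * (1 / real (Suc n)) / (1 + (1 / real (Suc n))\<^sup>2) * (pi / 2)"
      by (intro always_eventually allI arc) simp
    show "(\<lambda>n. C * (1 / real (Suc n)) / (1 + (1 / real (Suc n))\<^sup>2) * (pi / 2)) \<longlonglongrightarrow> 0" by real_asymp
  qed
  have "(\<lambda>n. (LBINT t:A n. \<i> * P (\<i> * of_real t)) - (LBINT t:A n. P (of_real t))) \<longlonglongrightarrow> 0"
    using tendsto_diff[OF z1 z2] unfolding i1 i2 by (simp add: algebra_simps)
  with tendsto_diff[OF lim2 lim1]
  have "(LBINT t:{0<..}. \<i> * P (\<i> * of_real t)) - (LBINT t:{0<..}. P (of_real t)) = 0"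
    by (rule LIMSEQ_unique)
  then show "(LBINT t:{0<..}. P (of_real t)) = (LBINT t:{0<..}. \<i> * P (\<i> * of_real t))" by simp
qed

section \<open>The entire function that joins the two Bessel functions of the first kind\<close>

text \<open>The entire extension of \<open>I\<^sub>0\<close>. On the imaginary axis it is
\<open>J\<^sub>0\<close>.\<close>

definition cI0 :: "complex \<Rightarrow> complex" where
  "cI0 w = (LBINT \<theta>:{0..pi}. exp (w * of_real (cos \<theta>))) / pi"

text \<open>The antiderivative is \<open>cos\<^sup>n\<^sup>+\<^sup>1 \<theta> sin \<theta>\<close>, which
vanishes at both ends of the interval. This is the recursion behind the Wallis integrals.\<close>

lemma has_integral_cos_power_step:
  "((\<lambda>\<theta>. (real n + 2) * cos \<theta> ^ (n + 2) - (real n + 1) * cos \<theta> ^ n) has_integral 0) {0..pi}"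
proof -
  have "((\<lambda>\<theta>. (real n + 2) * cos \<theta> ^ (n + 2) - (real n + 1) * cos \<theta> ^ n) has_integral
      (cos pi ^ (n + 1) * sin pi - cos 0 ^ (n + 1) * sin 0)) {0..pi::real}"
  proof (rule fundamental_theorem_of_calculus)
    fix x :: real
    have "((\<lambda>x. cos x ^ (n + 1) * sin x) has_real_derivative
        (- ((real n + 1) * cos x ^ n * sin x) * sin x + cos x ^ (n+1) * cos x)) (at x within {0..pi})"
      by (rule derivative_eq_intros refl | simp)+
    also have "- ((real n + 1) * cos x ^ n * sin x) * sin x + cos x ^ (n+1) * cos x
        = - (real n + 1) * cos x ^ n * (sin x)\<^sup>2 + cos x ^ (n + 2)"
      by (simp add: power2_eq_square algebra_simps)
    also have "\<dots> = (real n + 2) * cos x ^ (n + 2) - (real n + 1) * cos x ^ n"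
      unfolding sin_squared_eq by (simp add: power2_eq_square algebra_simps)
    finally show "((\<lambda>x. cos x ^ (n + 1) * sin x) has_vector_derivative
        (real n + 2) * cos x ^ (n + 2) - (real n + 1) * cos x ^ n) (at x within {0..pi})"
      unfolding has_real_derivative_iff_has_vector_derivative .
  qed simp
  then show ?thesis by (simp only: sin_pi sin_zero mult_zero_right diff_zero)
qed

lemma has_integral_cos_power_add_2:
  assumes "((\<lambda>\<theta>. cos \<theta> ^ n) has_integral I) {0..pi}"
  shows "((\<lambda>\<theta>. cos \<theta> ^ (n + 2)) has_integral (real n + 1) / (real n + 2) * I) {0..pi}"
proof -
  have "((\<lambda>\<theta>. (1 / (real n + 2)) * (((real n + 2) * cos \<theta> ^ (n + 2) - (real n + 1) * cos \<theta> ^ n)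
        + (real n + 1) * cos \<theta> ^ n))
      has_integral (1 / (real n + 2)) * (0 + (real n + 1) * I)) {0..pi}"
    by (intro has_integral_mult_right has_integral_add has_integral_cos_power_step assms)
  moreover have "1 / (real n + 2) * (((real n + 2) * c - d) + d) = c" for c d :: real
    by simp
  ultimately show ?thesis by simp
qed

lemma has_integral_cos_power_even:
  "((\<lambda>\<theta>. cos \<theta> ^ (2 * m)) has_integral (pi * fact (2 * m) / (4 ^ m * (fact m)\<^sup>2))) {0..pi}"
proof (induction m)
  case 0
  show ?case using has_integral_const_real[of "1::real" 0 pi] by simp
next
  case (Suc m)
  have eq: "(real (2 * m) + 1) / (real (2 * m) + 2) * (pi * fact (2 * m) / (4 ^ m * (fact m)\<^sup>2))
      = pi * fact (2 * Suc m) / (4 ^ Suc m * (fact (Suc m))\<^sup>2)"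
    by (simp add: divide_simps power2_eq_square) (simp add: algebra_simps)
  have "2 * Suc m = 2 * m + 2" by simp
  then show ?case using has_integral_cos_power_add_2[OF Suc.IH] unfolding eq by (simp only:)
qed

lemma has_integral_cos_power_odd:
  "((\<lambda>\<theta>. cos \<theta> ^ (2 * m + 1)) has_integral (0::real)) {0..pi}"
proof (induction m)
  case 0
  have "(cos has_integral (sin pi - sin 0)) {0..pi}"
    by (rule fundamental_theorem_of_calculus)
       (auto intro!: derivative_eq_intros simp flip: has_real_derivative_iff_has_vector_derivative)
  then show ?case by simp
next
  case (Suc m)
  show ?case using has_integral_cos_power_add_2[OF Suc.IH] by simp
qed

text \<open>Expand the exponential and integrate term by term: the odd moments of the cosine vanish, and the
even ones turn \<open>1 / (2m)!\<close> into \<open>1 / (4\<^sup>m (m!)\<^sup>2)\<close>.\<close>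

lemma cI0_sums: "(\<lambda>m. (w / 2) ^ (2 * m) / (fact m)\<^sup>2) sums cI0 w"
proof -
  define M :: "nat \<Rightarrow> real" where "M n = (LBINT \<theta>:{0..pi}. cos \<theta> ^ n)" for n
  have M_even: "M (2 * m) = pi * fact (2 * m) / (4 ^ m * (fact m)\<^sup>2)" for m
    unfolding M_def by (intro LBINT_eqI has_integral_cos_power_even continuous_intros)
  have M_odd: "M (2 * m + 1) = 0" for m
    unfolding M_def by (intro LBINT_eqI has_integral_cos_power_odd continuous_intros)
  define f where "f n \<theta> = indicator {0..pi} \<theta> *\<^sub>R ((w * of_real (cos \<theta>)) ^ n /\<^sub>R fact n)" for n \<theta>
  have int_f: "integral\<^sup>L lborel (f n) = w ^ n / fact n * of_real (M n)" for n
  proof -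
    have "integral\<^sup>L lborel (f n) = (LBINT \<theta>:{0..pi}. w ^ n / fact n * of_real (cos \<theta> ^ n))"
      unfolding set_lebesgue_integral_def f_def
      by (simp add: power_mult_distrib scaleR_conv_of_real field_simps)
    also have "\<dots> = w ^ n / fact n * (LBINT \<theta>:{0..pi}. of_real (cos \<theta> ^ n))"
      by (rule set_integral_mult_right)
    finally show ?thesis unfolding M_def set_integral_complex_of_real .
  qed
  have fi: "integrable lborel (f n)" for n
  proof -
    have "set_integrable lborel {0..pi} (\<lambda>\<theta>. (w * of_real (cos \<theta>)) ^ n /\<^sub>R fact n)"
      by (intro set_integrable_interval continuous_intros)
    then show ?thesis by (simp only: f_def[abs_def] set_integrable_def)
  qed
  have norm_f: "norm (f n \<theta>) \<le> indicator {0..pi} \<theta> *\<^sub>R (norm w ^ n /\<^sub>R fact n)" for n \<theta>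
    by (auto simp: f_def norm_mult norm_power power_mult_distrib divide_simps split: split_indicator
             intro!: mult_left_le power_le_one)
  have "(\<lambda>n. integral\<^sup>L lborel (f n)) sums (\<integral>\<theta>. (\<Sum>n. f n \<theta>) \<partial>lborel)"
  proof (rule sums_integral)
    show "AE \<theta> in lborel. summable (\<lambda>n. norm (f n \<theta>))"
    proof (intro AE_I2)
      fix \<theta>
      show "summable (\<lambda>n. norm (f n \<theta>))"
        by (rule summable_comparison_test'[OF summable_norm_exp[of "w * of_real (cos \<theta>)"]])
           (simp add: f_def indicator_def)
    qed
    show "summable (\<lambda>n. \<integral>\<theta>. norm (f n \<theta>) \<partial>lborel)"
    proof (rule summable_comparison_test')
      show "summable (\<lambda>n. pi * (norm w ^ n /\<^sub>R fact n))"
        by (intro summable_mult summable_exp_generic)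
      fix n
      have "(\<integral>\<theta>. norm (f n \<theta>) \<partial>lborel) \<le> (LBINT \<theta>:{0..pi}. norm w ^ n /\<^sub>R fact n)"
        unfolding set_lebesgue_integral_def
        using set_integrable_interval[of 0 pi "\<lambda>_. norm w ^ n /\<^sub>R fact n"] norm_f fi
        by (intro integral_mono) (auto simp: set_integrable_def)
      also have "\<dots> = pi * (norm w ^ n /\<^sub>R fact n)"
        by (simp add: set_integral_const)
      finally show "norm (\<integral>\<theta>. norm (f n \<theta>) \<partial>lborel) \<le> pi * (norm w ^ n /\<^sub>R fact n)" by simp
    qed
  qed (rule fi)
  also have "(\<integral>\<theta>. (\<Sum>n. f n \<theta>) \<partial>lborel) = pi * cI0 w"
    unfolding cI0_def set_lebesgue_integral_def f_def exp_def
    by (auto intro!: Bochner_Integration.integral_cong split: split_indicator)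
  finally have "(\<lambda>n. w ^ n / fact n * of_real (M n)) sums (pi * cI0 w)"
    by (simp add: int_f)
  then have "(\<lambda>n. 1 / pi * (w ^ n / fact n * of_real (M n))) sums (1 / pi * (pi * cI0 w))"
    by (rule sums_mult)
  then have all: "(\<lambda>n. w ^ n / fact n * of_real (M n) / pi) sums cI0 w"
    by (simp add: mult.commute)
  have "(\<lambda>m. w ^ (2 * m) / fact (2 * m) * of_real (M (2 * m)) / pi) sums cI0 w"
  proof (subst sums_mono_reindex[of "\<lambda>m. 2 * m" "\<lambda>n. w ^ n / fact n * of_real (M n) / pi"])
    show "strict_mono (\<lambda>m::nat. 2 * m)" by (simp add: strict_mono_def)
    fix n :: nat assume "n \<notin> range (\<lambda>m. 2 * m)"
    then obtain m where "n = 2 * m + 1" by (metis evenE oddE rangeI)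
    then show "w ^ n / fact n * of_real (M n) / pi = 0" using M_odd by simp
  qed (rule all)
  moreover have "w ^ (2 * m) / fact (2 * m) * of_real (M (2 * m)) / pi = (w / 2) ^ (2 * m) / (fact m)\<^sup>2" for m
    unfolding M_even by (simp add: power_divide power_mult)
  ultimately show ?thesis by simp
qed

lemma cI0_of_real: "cI0 (of_real t) = of_real (bessel_I0 t)"
proof -
  have "(LBINT \<theta>:{0..pi}. exp (complex_of_real t * of_real (cos \<theta>)))
      = (LBINT \<theta>:{0..pi}. of_real (exp (t * cos \<theta>)))"
    by (simp flip: exp_of_real)
  then show ?thesis
    by (simp add: cI0_def bessel_I0_def set_integral_complex_of_real)
qed

lemma bessel_I0_sums: "(\<lambda>m. (t / 2) ^ (2 * m) / (fact m)\<^sup>2) sums bessel_I0 t"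
  using cI0_sums[of "of_real t"] unfolding cI0_of_real
  by (subst sums_of_real_iff[symmetric, where 'a = complex]) simp

lemma cI0_ii: "cI0 (\<i> * of_real t) = of_real (bessel_J0 t)"
proof -
  have "((\<i> * of_real t) / 2) ^ (2 * m) / (fact m)\<^sup>2
      = complex_of_real ((- 1) ^ m / (fact m)\<^sup>2 * (t / 2) ^ (2 * m))" for m
    by (simp add: power_mult power_divide power_mult_distrib power_minus')
  then have s: "(\<lambda>m. complex_of_real ((- 1) ^ m / (fact m)\<^sup>2 * (t / 2) ^ (2 * m))) sums cI0 (\<i> * of_real t)"
    using cI0_sums[of "\<i> * of_real t"] by simp
  then have "(\<lambda>m. (- 1) ^ m / (fact m)\<^sup>2 * (t / 2) ^ (2 * m)) sums Re (cI0 (\<i> * of_real t))"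
    using sums_Re[OF s] by (simp only: Re_complex_of_real)
  then have "bessel_J0 t = Re (cI0 (\<i> * of_real t))"
    by (simp add: bessel_J0_def sums_iff)
  moreover have "(\<lambda>m. 0) sums Im (cI0 (\<i> * of_real t))" using sums_Im[OF s] by (simp only: Im_complex_of_real)
  then have "Im (cI0 (\<i> * of_real t)) = 0" by (simp add: sums_iff)
  ultimately show ?thesis by (simp add: complex_eq_iff)
qed

lemma cos_integral_holomorphic:
  "(\<lambda>w. LBINT \<theta>:{a..b}. exp (w * of_real (cos \<theta>))) holomorphic_on UNIV"
proof (rule holomorphic_on_set_integral)
  fix w :: complex
  show "set_borel_measurable lborel {a..b} (\<lambda>\<theta>. exp (w * of_real (cos \<theta>)))"
    unfolding set_borel_measurable_def
    by (simp add: borel_measurable_continuous_on_indicator continuous_intros)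
  have "norm (exp (z * of_real (cos \<theta>))) \<le> exp (norm w + 1)" if "z \<in> ball w 1" for z \<theta>
  proof -
    have "Re z * cos \<theta> \<le> \<bar>Re z\<bar> * \<bar>cos \<theta>\<bar>" by (metis abs_ge_self abs_mult)
    also have "\<dots> \<le> \<bar>Re z\<bar> * 1" by (intro mult_left_mono) auto
    also have "\<dots> \<le> norm z" by (simp add: abs_Re_le_cmod)
    also have "\<dots> \<le> norm w + 1"
      using that norm_triangle_ineq2[of z w] by (simp add: dist_norm norm_minus_commute)
    finally show ?thesis by simp
  qed
  then show "\<exists>r>0. \<exists>h. ball w r \<subseteq> UNIV \<and> set_integrable lborel {a..b} h \<and>
      (\<forall>z\<in>ball w r. \<forall>\<theta>\<in>{a..b}. norm (exp (z * of_real (cos \<theta>))) \<le> h \<theta>)"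
    by (intro exI[of _ 1] conjI exI[of _ "\<lambda>_. exp (norm w + 1)"] set_integrable_interval) auto
qed (auto intro!: holomorphic_intros)

lemma cI0_holomorphic: "cI0 holomorphic_on UNIV"
  unfolding cI0_def[abs_def] by (intro holomorphic_intros cos_integral_holomorphic) auto

section \<open>Growth of cI0\<close>

lemma norm_cI0_le_exp:
  assumes "Re w \<ge> 0"
  shows "norm (cI0 w) \<le> exp (Re w)"
proof -
  have "norm (LBINT \<theta>:{0..pi}. exp (w * of_real (cos \<theta>))) \<le> (LBINT \<theta>:{0..pi}. exp (Re w))"
    using assms
    by (intro set_integral_dominated_le set_integrable_interval continuous_intros)
       (auto simp: mult_left_le)
  also have "\<dots> = pi * exp (Re w)" by (simp add: set_integral_const)
  finally show ?thesis by (simp add: cI0_def norm_divide divide_simps mult.commute)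
qed

lemma half_le_sin:
  assumes "0 \<le> x" "x \<le> (1::real)"
  shows "x / 2 \<le> sin x"
proof (cases "x = 0")
  case False
  with assms have "0 < x" by simp
  from MVT2[OF this, of sin cos] obtain c where c: "0 < c" "c < x" "sin x - sin 0 = (x - 0) * cos c"
    by (auto intro: DERIV_sin)
  have "cos (pi / 3) \<le> cos c" using c assms pi_gt3 by (intro cos_monotone_0_pi_le) auto
  then have "x * (1 / 2) \<le> x * cos c" using assms by (intro mult_left_mono) (auto simp: cos_60)
  then show ?thesis using c by simp
qed simp

text \<open>The factor \<open>|w|\<^sup>-\<^sup>1\<^sup>/\<^sup>2\<close> comes from the stationary
points \<open>\<theta> = 0\<close> and \<open>\<theta> = \<pi>\<close> of the exponent. Intervals
of length \<open>\<delta> = |w|\<^sup>-\<^sup>1\<^sup>/\<^sup>2\<close> around them are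
estimated trivially. On the rest, partial integration against
\<open>-1 / (w sin \<theta>)\<close> gains \<open>1 / |w|\<close> and loses
\<open>1 / sin \<delta>\<close>, that is, at most \<open>2 / \<delta>\<close>. The estimate is uniform
up to the imaginary axis, where there is no exponential growth to absorb a loss.\<close>

lemma norm_cI0_le_decay:
  assumes "Re w \<ge> 0" "norm w \<ge> 1"
  shows "norm (cI0 w) \<le> 10 * exp (Re w) / sqrt (norm w)"
proof -
  define \<delta> where "\<delta> = 1 / sqrt (norm w)"
  define a where "a = exp (Re w)"
  define E where "E \<theta> = exp (w * of_real (cos \<theta>))" for \<theta> :: real
  have w0: "w \<noteq> 0" using assms by auto
  have "sqrt 1 \<le> sqrt (norm w)" using assms by (intro real_sqrt_le_mono)
  then have \<delta>: "0 < \<delta>" "\<delta> \<le> 1" using w0 by (auto simp: \<delta>_def)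
  have \<delta>2: "\<delta>\<^sup>2 = 1 / norm w" using assms by (simp add: \<delta>_def power_divide)
  have sin\<delta>: "\<delta> / 2 \<le> sin \<delta>" using half_le_sin \<delta> by simp
  have cE: "continuous_on S E" for S unfolding E_def by (intro continuous_intros)
  have nE: "norm (E \<theta>) \<le> a" for \<theta>
    using assms(1) by (simp add: E_def a_def mult_left_le)
  have iE: "E integrable_on {s..t}" for s t by (intro integrable_continuous_real cE)
  define p where "p = pi - \<delta>"
  have p: "\<delta> < p" "p < pi" using \<delta> pi_gt3 by (auto simp: p_def)
  have sinpos: "sin \<theta> > 0" if "\<theta> \<in> {\<delta>..p}" for \<theta>
    using that \<delta> p by (intro sin_gt_zero) auto
  have e1: "norm (integral {0..\<delta>} E) \<le> a * (\<delta> - 0)"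
    by (intro integral_bound cE nE) (use \<delta> in auto)
  have e2: "norm (integral {p..pi} E) \<le> a * (pi - p)"
    by (intro integral_bound cE nE) (use p in auto)
  \<comment> \<open>\<open>G\<close> is the boundary term of the partial integration and \<open>R\<close> the integrand that remains; \<open>|R|\<close> is dominated by a multiple of \<open>1 / sin\<^sup>2\<close>, whose primitive is \<open>- cot\<close>.\<close>
  define G where "G \<theta> = - E \<theta> / (w * of_real (sin \<theta>))" for \<theta>
  define R where "R \<theta> = E \<theta> * of_real (cos \<theta>) / (w * of_real (sin \<theta>) ^ 2)" for \<theta>
  have G': "((\<lambda>\<theta>. E \<theta> + R \<theta>) has_integral (G p - G \<delta>)) {\<delta>..p}"
  proof (rule fundamental_theorem_of_calculus)
    fix \<theta> assume "\<theta> \<in> {\<delta>..p}"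
    then have s: "sin \<theta> \<noteq> 0" using sinpos by fastforce
    have dc: "((\<lambda>\<theta>. complex_of_real (cos \<theta>)) has_vector_derivative of_real (- sin \<theta>)) (at \<theta> within {\<delta>..p})"
      and ds: "((\<lambda>\<theta>. complex_of_real (sin \<theta>)) has_vector_derivative of_real (cos \<theta>)) (at \<theta> within {\<delta>..p})"
      by (auto intro!: has_vector_derivative_of_real derivative_eq_intros)
    have dE: "(E has_vector_derivative of_real (- sin \<theta>) * (w * E \<theta>)) (at \<theta> within {\<delta>..p})"
    proof -
      have "((\<lambda>z. exp (w * z)) has_field_derivative w * E \<theta>)
          (at (of_real (cos \<theta>)) within (\<lambda>\<theta>. complex_of_real (cos \<theta>)) ` {\<delta>..p})"
        unfolding E_def by (auto intro!: derivative_eq_intros)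
      from field_vector_diff_chain_within[OF dc this] show ?thesis
        by (simp only: o_def E_def[abs_def])
    qed
    have di: "((\<lambda>\<theta>. inverse (w * complex_of_real (sin \<theta>))) has_vector_derivative
        of_real (cos \<theta>) * (- w / (w * of_real (sin \<theta>))\<^sup>2)) (at \<theta> within {\<delta>..p})"
    proof -
      have "((\<lambda>z. inverse (w * z)) has_field_derivative - w / (w * of_real (sin \<theta>))\<^sup>2)
          (at (of_real (sin \<theta>)) within (\<lambda>\<theta>. complex_of_real (sin \<theta>)) ` {\<delta>..p})"
        using s w0 by (auto intro!: derivative_eq_intros simp: power2_eq_square divide_simps)
      from field_vector_diff_chain_within[OF ds this] show ?thesis
        by (simp only: o_def)
    qed
    have "((\<lambda>\<theta>. E \<theta> * inverse (w * complex_of_real (sin \<theta>))) has_vector_derivative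
        E \<theta> * (of_real (cos \<theta>) * (- w / (w * of_real (sin \<theta>))\<^sup>2))
        + (of_real (- sin \<theta>) * (w * E \<theta>)) * inverse (w * of_real (sin \<theta>))) (at \<theta> within {\<delta>..p})"
      by (rule has_vector_derivative_mult[OF dE di])
    from has_vector_derivative_minus[OF this]
    moreover have "(\<lambda>\<theta>. - (E \<theta> * inverse (w * complex_of_real (sin \<theta>)))) = G"
      by (simp add: G_def[abs_def] divide_inverse)
    moreover have "- (E \<theta> * (of_real (cos \<theta>) * (- w / (w * of_real (sin \<theta>))\<^sup>2))
        + (of_real (- sin \<theta>) * (w * E \<theta>)) * inverse (w * of_real (sin \<theta>))) = E \<theta> + R \<theta>"
      using s w0 by (simp add: R_def field_simps power2_eq_square)
    ultimately show "(G has_vector_derivative E \<theta> + R \<theta>) (at \<theta> within {\<delta>..p})"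
      by (simp only:)
  qed (use p in simp)
  have cR: "continuous_on {\<delta>..p} R"
    unfolding R_def using w0 sinpos by (intro continuous_intros cE) fastforce+
  have iR: "R integrable_on {\<delta>..p}" by (intro integrable_continuous_real cR)
  define T where "T = cos \<delta> / sin \<delta> - cos p / sin p"
  have T: "((\<lambda>\<theta>. a / norm w * (1 / (sin \<theta>)\<^sup>2)) has_integral (a / norm w * T)) {\<delta>..p}"
  proof (rule has_integral_mult_right)
    have "((\<lambda>\<theta>. 1 / (sin \<theta>)\<^sup>2) has_integral (- cos p / sin p - (- cos \<delta> / sin \<delta>))) {\<delta>..p}"
    proof (rule fundamental_theorem_of_calculus)
      fix \<theta> assume "\<theta> \<in> {\<delta>..p}"
      then have s: "sin \<theta> \<noteq> 0" using sinpos by fastforce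
      have "((\<lambda>\<theta>. - cos \<theta> / sin \<theta>) has_real_derivative
          ((sin \<theta> * sin \<theta> + cos \<theta> * cos \<theta>) / (sin \<theta> * sin \<theta>))) (at \<theta> within {\<delta>..p})"
        using s by (auto intro!: derivative_eq_intros) (simp add: divide_simps flip: power2_eq_square)
      also have "(sin \<theta> * sin \<theta> + cos \<theta> * cos \<theta>) = 1"
        by (simp flip: power2_eq_square)
      finally show "((\<lambda>\<theta>. - cos \<theta> / sin \<theta>) has_vector_derivative 1 / (sin \<theta>)\<^sup>2) (at \<theta> within {\<delta>..p})"
        unfolding power2_eq_square has_real_derivative_iff_has_vector_derivative .
    qed (use p in simp)
    then show "((\<lambda>\<theta>. 1 / (sin \<theta>)\<^sup>2) has_integral T) {\<delta>..p}" by (simp add: T_def)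
  qed
  have "norm (integral {\<delta>..p} R) \<le> integral {\<delta>..p} (\<lambda>\<theta>. a / norm w * (1 / (sin \<theta>)\<^sup>2))"
  proof (rule integral_norm_bound_integral[OF iR has_integral_integrable[OF T]])
    fix \<theta> assume "\<theta> \<in> {\<delta>..p}"
    have "norm (R \<theta>) = norm (E \<theta>) * \<bar>cos \<theta>\<bar> / (norm w * (sin \<theta>)\<^sup>2)"
      by (simp add: R_def norm_mult norm_divide norm_power)
    also have "\<dots> \<le> a * 1 / (norm w * (sin \<theta>)\<^sup>2)"
      using nE by (intro divide_right_mono mult_mono) (auto simp: a_def)
    finally show "norm (R \<theta>) \<le> a / norm w * (1 / (sin \<theta>)\<^sup>2)" by simp
  qed
  also have "\<dots> = a / norm w * T" using T by (rule integral_unique)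
  also have "T = 2 * (cos \<delta> / sin \<delta>)" by (simp add: T_def p_def)
  finally have m1: "norm (integral {\<delta>..p} R) \<le> a / norm w * (2 * (cos \<delta> / sin \<delta>))" .
  have spos: "sin \<delta> > 0" using sin\<delta> \<delta> by linarith
  have nG: "norm (G \<theta>) \<le> a / norm w * (1 / sin \<delta>)" if "sin \<theta> = sin \<delta>" for \<theta>
    using nE[of \<theta>] w0 spos that
    by (simp add: G_def norm_mult norm_divide divide_right_mono)
  have "integral {\<delta>..p} (\<lambda>\<theta>. E \<theta> + R \<theta>) = G p - G \<delta>" using G' by (rule integral_unique)
  then have "integral {\<delta>..p} E = G p - G \<delta> - integral {\<delta>..p} R"
    using integral_add[OF iE iR] by (simp add: algebra_simps)
  then have "norm (integral {\<delta>..p} E) \<le> norm (G p) + norm (G \<delta>) + norm (integral {\<delta>..p} R)"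
    using norm_triangle_ineq4[of "G p - G \<delta>" "integral {\<delta>..p} R"] norm_triangle_ineq4[of "G p" "G \<delta>"]
    by simp
  also have "\<dots> \<le> a / norm w * (1 / sin \<delta>) + a / norm w * (1 / sin \<delta>) + a / norm w * (2 * (cos \<delta> / sin \<delta>))"
    by (intro add_mono nG m1) (simp_all add: p_def)
  also have "\<dots> = a / norm w * ((2 + 2 * cos \<delta>) * (1 / sin \<delta>))"
    by (simp add: add_divide_distrib ring_distribs)
  also have "\<dots> \<le> a / norm w * (4 * (1 / (\<delta> / 2)))"
    using sin\<delta> spos \<delta> cos_le_one[of \<delta>]
    by (intro mult_left_mono mult_mono divide_left_mono) (auto simp: a_def)
  also have "\<dots> = a * \<delta>\<^sup>2 * (8 / \<delta>)" by (simp add: \<delta>2)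
  also have "\<dots> = 8 * a * \<delta>" using \<delta> by (simp add: power2_eq_square)
  finally have m: "norm (integral {\<delta>..p} E) \<le> 8 * a * \<delta>" .
  have "integral {0..pi} E = integral {0..\<delta>} E + (integral {\<delta>..p} E + integral {p..pi} E)"
    using \<delta> p by (simp add: Henstock_Kurzweil_Integration.integral_combine iE)
  then have "norm (integral {0..pi} E) \<le> norm (integral {0..\<delta>} E) + (norm (integral {\<delta>..p} E) + norm (integral {p..pi} E))"
    using norm_triangle_ineq[of "integral {0..\<delta>} E" "integral {\<delta>..p} E + integral {p..pi} E"]
      norm_triangle_ineq[of "integral {\<delta>..p} E" "integral {p..pi} E"]
    by simp
  also have "\<dots> \<le> a * \<delta> + (8 * a * \<delta> + a * \<delta>)"
    using e1 e2 m by (intro add_mono) (auto simp: p_def)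
  finally have n: "norm (integral {0..pi} E) \<le> 10 * a * \<delta>" by (simp add: mult_ac)
  have "cI0 w = integral {0..pi} E / pi"
    unfolding cI0_def E_def[symmetric]
    using set_borel_integral_eq_integral(2)[OF set_integrable_interval[OF cE]] by simp
  then have "norm (cI0 w) = norm (integral {0..pi} E) / pi" by (simp add: norm_divide)
  also have "\<dots> \<le> norm (integral {0..pi} E) / 1"
    using pi_gt3 by (intro divide_left_mono) auto
  finally show ?thesis using n by (simp add: a_def \<delta>_def)
qed

text \<open>The common profile of the bounds for both functions after removal of the exponential factor. The
exponent \<open>-1/2\<close> is the true decay at infinity. Near the origin \<open>K\<^sub>0\<close>
has a logarithmic singularity, which any negative exponent dominates. From \<open>-1/6\<close> on,
\<open>r (envelope r)\<^sup>6\<close> stays bounded there; \<open>-1/8\<close> is one such choice.\<close>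

definition envelope :: "real \<Rightarrow> real" where
  "envelope r = min (r powr (-1/8)) (r powr (-1/2))"

lemma envelope_nonneg: "envelope r \<ge> 0" by (simp add: envelope_def)

lemma norm_cI0_le_envelope:
  assumes "Re w \<ge> 0" "w \<noteq> 0"
  shows "norm (cI0 w) \<le> 10 * exp (Re w) * envelope (norm w)"
proof (cases "norm w \<le> 1")
  case True
  have "norm w powr 0 \<le> norm w powr (-1/8)" "norm w powr 0 \<le> norm w powr (-1/2)"
    using True by (intro powr_mono'; simp)+
  then have "1 \<le> envelope (norm w)" using assms by (simp add: envelope_def)
  have "norm (cI0 w) \<le> exp (Re w) * 1" using norm_cI0_le_exp[OF assms(1)] by simp
  also have "\<dots> \<le> exp (Re w) * (10 * envelope (norm w))"
    using \<open>1 \<le> envelope (norm w)\<close> by (intro mult_left_mono) auto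
  finally show ?thesis by (simp only: mult_ac)
next
  case False
  then have "norm w powr (-1/2) \<le> norm w powr (-1/8)" by (intro powr_mono) auto
  moreover have "norm w powr (-1/2) = 1 / sqrt (norm w)"
    using powr_minus_divide[of "norm w" "1/2"] by (simp add: powr_half_sqrt)
  ultimately have "envelope (norm w) = 1 / sqrt (norm w)" unfolding envelope_def by (metis min.absorb2)
  then show ?thesis using norm_cI0_le_decay[of w] False assms by simp
qed

lemma envelope_scale:
  assumes "x > 0" "r > 0"
  shows "envelope (x * r) \<le> (1 + x powr (-1/2)) * envelope r"
proof -
  have "x powr (-1/8) \<le> 1 + x powr (-1/2)"
  proof (cases "x \<le> 1")
    case True
    then have "x powr (-1/8) \<le> x powr (-1/2)" using assms by (intro powr_mono') auto
    then show ?thesis by simp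
  next
    case False
    then have "x powr (-1/8) \<le> x powr 0" by (intro powr_mono) auto
    then show ?thesis using assms by (simp add: add_increasing2)
  qed
  then have "(x powr (-1/8)) * (r powr (-1/8)) \<le> (1 + x powr (-1/2)) * (r powr (-1/8))"
    by (intro mult_right_mono) auto
  moreover have "(x powr (-1/2)) * (r powr (-1/2)) \<le> (1 + x powr (-1/2)) * (r powr (-1/2))"
    by (intro mult_right_mono) auto
  ultimately show ?thesis
    using assms unfolding envelope_def by (simp add: powr_mult min_mult_distrib_left min_le_iff_disj min.coboundedI1 min.coboundedI2 split: if_splits)
qed

text \<open>Each integrand below is a factor \<open>r\<close> times six Bessel factors. Its profile is thus at
most \<open>r\<^sup>1\<^sup>/\<^sup>4\<close> for \<open>r \<le> 1\<close> and
\<open>r\<^sup>-\<^sup>2\<close> for \<open>r \<ge> 1\<close>.\<close>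

lemma envelope_power_6_bound:
  assumes "r > 0"
  shows "r * envelope r ^ 6 * (1 + r\<^sup>2) \<le> 2"
proof (cases "r \<le> 1")
  case True
  have "envelope r ^ 6 \<le> (r powr (-1/8)) ^ 6" by (intro power_mono envelope_nonneg) (simp add: envelope_def)
  also have "\<dots> = r powr (-3/4)" using assms by (simp add: powr_power)
  finally have "r * envelope r ^ 6 * (1 + r\<^sup>2) \<le> r * r powr (-3/4) * 2"
    using True assms by (intro mult_mono) (auto simp: envelope_nonneg power_le_one)
  also have "r * r powr (-3/4) = r powr (1/4)"
    using assms powr_add[of r 1 "-3/4"] by simp
  also have "\<dots> \<le> 1" using True assms powr_le1 by simp
  finally show ?thesis by simp
next
  case False
  have "envelope r ^ 6 \<le> (r powr (-1/2)) ^ 6" by (intro power_mono envelope_nonneg) (simp add: envelope_def)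
  also have "\<dots> = r powr (-3)" using assms by (simp add: powr_power)
  also have "\<dots> = 1 / r ^ 3" using assms by (simp add: powr_minus_divide powr_numeral)
  finally have "r * envelope r ^ 6 * (1 + r\<^sup>2) \<le> r * (1 / r ^ 3) * (1 + r\<^sup>2)"
    using assms by (intro mult_mono) (auto simp: envelope_nonneg)
  also have "\<dots> = (1 + r\<^sup>2) / r\<^sup>2" using assms by (simp add: power2_eq_square power3_eq_cube)
  also have "\<dots> \<le> 2" using False by (simp add: divide_simps)
  finally show ?thesis .
qed

section \<open>The continuation of K0 to a half-plane\<close>

text \<open>This is the integral of \<open>exp (- w cosh u)\<close> over \<open>u > 0\<close> after the substitution
\<open>v = w (cosh u - 1)\<close>. Unlike the original, this form converges absolutely up to and
beyond the imaginary axis, and it displays the exponential decay as a factor.\<close>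

definition cK0 :: "complex \<Rightarrow> complex" where
  "cK0 w = exp (- w) * (LBINT v:{0<..}. of_real (exp (- v) / sqrt v) / csqrt (of_real v + 2 * w))"

lemma set_integrable_Gamma:
  assumes "s > (0::real)"
  shows "set_integrable lborel {0<..} (\<lambda>v. exp (- v) * v powr (s - 1))"
proof -
  have "integrable lborel (\<lambda>t. indicator {0..} t * t powr (s - 1) / exp t)"
    using Gamma_conv_nn_integral_real[OF assms]
    by (intro integrableI_nn_integral_finite[where x = "Gamma s"]) auto
  then have "set_integrable lborel {0..} (\<lambda>v. exp (- v) * v powr (s - 1))"
    by (simp add: set_integrable_def exp_minus field_simps)
  then show ?thesis by (rule set_integrable_subset) auto
qed

lemma cK0_integrand_continuous:
  assumes "w \<in> halfplane"
  shows "continuous_on {0<..} (\<lambda>v. of_real (exp (- v) / sqrt v) / csqrt (of_real v + 2 * w))"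
proof -
  have "of_real v + 2 * w \<notin> \<real>\<^sub>\<le>\<^sub>0" if "v > 0" for v
    using assms that by (intro add_pos_notin_nonpos_Reals) auto
  then have "continuous_on {0<..} (\<lambda>v. csqrt (of_real v + 2 * w))"
    by (intro continuous_on_compose2[OF continuous_on_csqrt] continuous_intros) auto
  moreover have "csqrt (of_real v + 2 * w) \<noteq> 0" if "v > 0" for v
    using \<open>v > 0 \<Longrightarrow> of_real v + 2 * w \<notin> \<real>\<^sub>\<le>\<^sub>0\<close> that by auto
  ultimately show ?thesis by (intro continuous_intros) auto
qed

lemma cK0_holomorphic: "cK0 holomorphic_on halfplane"
proof -
  have "(\<lambda>w. LBINT v:{0<..}. of_real (exp (- v) / sqrt v) / csqrt (of_real v + 2 * w)) holomorphic_on halfplane"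
  proof (rule holomorphic_on_set_integral[OF open_halfplane])
    fix w assume w: "w \<in> halfplane"
    show "set_borel_measurable lborel {0<..} (\<lambda>v. of_real (exp (- v) / sqrt v) / csqrt (of_real v + 2 * w))"
      unfolding set_borel_measurable_def
      using borel_measurable_continuous_on_indicator[OF _ cK0_integrand_continuous[OF w]] by simp
    define c where "c = Re w + Im w"
    have c: "c > 0" using w by (simp add: c_def)
    have lower: "Re u + Im u > c / 2" if "u \<in> ball w (c / 4)" for u
    proof -
      have "norm (w - u) < c / 4" using that by (simp add: dist_norm)
      then have "Re w - Re u < c / 4" "Im w - Im u < c / 4"
        using complex_Re_le_cmod[of "w - u"] abs_Im_le_cmod[of "w - u"] by auto
      then show ?thesis unfolding c_def by argo
    qed
    show "\<exists>r>0. \<exists>h. ball w r \<subseteq> halfplane \<and> set_integrable lborel {0<..} h \<and>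
        (\<forall>u\<in>ball w r. \<forall>v\<in>{0<..}. norm (of_real (exp (- v) / sqrt v) / csqrt (of_real v + 2 * u)) \<le> h v)"
    proof (intro exI[of _ "c / 4"] exI[of _ "\<lambda>v. (exp (- v) * v powr (1/2 - 1)) / sqrt (c / 2)"] conjI ballI)
      show "ball w (c / 4) \<subseteq> halfplane" using lower c by fastforce
      show "set_integrable lborel {0<..} (\<lambda>v. (exp (- v) * v powr (1/2 - 1)) / sqrt (c / 2))"
        by (intro set_integrable_divide set_integrable_Gamma) simp
      fix u and v :: real assume u: "u \<in> ball w (c / 4)" and "v \<in> {0<..}"
      then have v: "v > 0" by simp
      let ?z = "of_real v + 2 * u"
      have "c \<le> Re ?z + Im ?z" using lower[OF u] v by simp
      also have "\<dots> \<le> norm ?z + norm ?z" by (intro add_mono complex_Re_le_cmod abs_Im_le_cmod[THEN order_trans[OF abs_ge_self]])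
      finally have "sqrt (c / 2) \<le> sqrt (norm ?z)" by simp
      then have "exp (- v) / sqrt v / sqrt (norm ?z) \<le> exp (- v) / sqrt v / sqrt (c / 2)"
        using v c by (intro divide_left_mono mult_pos_pos) (auto intro: order_less_le_trans)
      moreover have "v powr (1/2 - 1) = 1 / sqrt v"
        using v powr_minus_divide[of v "1/2"] by (simp add: powr_half_sqrt)
      ultimately show "norm (of_real (exp (- v) / sqrt v) / csqrt ?z) \<le> (exp (- v) * v powr (1/2 - 1)) / sqrt (c / 2)"
        using v by (simp add: norm_divide norm_mult)
    qed (use c in simp)
  next
    fix v :: real assume "v \<in> {0<..}"
    then have "of_real v + 2 * w \<notin> \<real>\<^sub>\<le>\<^sub>0" if "w \<in> halfplane" for w
      using that by (intro add_pos_notin_nonpos_Reals) auto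
    moreover from this have "csqrt (of_real v + 2 * w) \<noteq> 0" if "w \<in> halfplane" for w
      using that by fastforce
    ultimately show "(\<lambda>w. of_real (exp (- v) / sqrt v) / csqrt (of_real v + 2 * w)) holomorphic_on halfplane"
      by (intro holomorphic_intros) auto
  qed
  then show ?thesis unfolding cK0_def[abs_def] by (intro holomorphic_intros)
qed

text \<open>In the first quadrant \<open>|v + 2w|\<close> is at least \<open>v\<close> and at least
\<open>|w|\<close>. Distributing the square root between the two lower bounds gives one estimate for
each \<open>s\<close>: \<open>s = 1/2\<close> is sharp at infinity, small \<open>s\<close> is good at
the origin.\<close>

lemma norm_cK0_le_powr:
  assumes w: "Re w \<ge> 0" "Im w \<ge> 0" "w \<noteq> 0" and s: "0 < s" "s \<le> 1 / 2"
  shows "norm (cK0 w) \<le> (LBINT v:{0<..}. exp (- v) * v powr (s - 1)) * exp (- Re w) * norm w powr (- s)"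
proof -
  have hw: "w \<in> halfplane" using w by (auto simp: complex_eq_iff)
  have "norm (LBINT v:{0<..}. of_real (exp (- v) / sqrt v) / csqrt (of_real v + 2 * w))
      \<le> (LBINT v:{0<..}. (exp (- v) * v powr (s - 1)) * norm w powr (- s))"
  proof (rule set_integral_dominated_le)
    fix v :: real assume "v \<in> {0<..}"
    then have v: "v > 0" by simp
    let ?z = "of_real v + 2 * w"
    have "norm w \<le> norm ?z" "v \<le> norm ?z"
    proof -
      have "Re w ^ 2 \<le> Re ?z ^ 2" "Im w ^ 2 \<le> Im ?z ^ 2"
        using v w by (auto intro!: power_mono)
      then show "norm w \<le> norm ?z"
        unfolding cmod_def by (intro real_sqrt_le_mono add_mono)
      have "v \<le> Re ?z" using v w by simp
      then show "v \<le> norm ?z" using complex_Re_le_cmod order_trans by blast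
    qed
    then have "v powr (1/2 - s) * norm w powr s \<le> norm ?z powr (1/2 - s) * norm ?z powr s"
      using v w s by (intro mult_mono powr_mono2) auto
    also have "\<dots> = sqrt (norm ?z)"
      using v \<open>v \<le> norm ?z\<close> by (simp flip: powr_add powr_half_sqrt)
    finally have le: "v powr (1/2 - s) * norm w powr s \<le> sqrt (norm ?z)" .
    have "norm (of_real (exp (- v) / sqrt v) / csqrt ?z) = exp (- v) / sqrt v / sqrt (norm ?z)"
      using v by (simp add: norm_divide norm_mult)
    also have "\<dots> \<le> exp (- v) / sqrt v / (v powr (1/2 - s) * norm w powr s)"
      using le v w \<open>v \<le> norm ?z\<close>
      by (intro divide_left_mono mult_pos_pos) (auto simp del: zero_less_norm_iff intro: order_less_le_trans)
    also have "\<dots> = exp (- v) * (1 / (v powr (1/2) * v powr (1/2 - s))) * (1 / norm w powr s)"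
      using v by (simp add: powr_half_sqrt)
    also have "v powr (1/2) * v powr (1/2 - s) = v powr (1 - s)"
      by (simp flip: powr_add)
    also have "1 / v powr (1 - s) = v powr (s - 1)"
      using powr_minus_divide[of v "1 - s"] by simp
    also have "1 / norm w powr s = norm w powr (- s)"
      by (simp add: powr_minus_divide)
    finally show "norm (of_real (exp (- v) / sqrt v) / csqrt ?z) \<le> (exp (- v) * v powr (s - 1)) * norm w powr (- s)" .
  next
    show "continuous_on {0<..} (\<lambda>v. of_real (exp (- v) / sqrt v) / csqrt (of_real v + 2 * w))"
      by (rule cK0_integrand_continuous[OF hw])
    show "set_integrable lborel {0<..} (\<lambda>v. exp (- v) * v powr (s - 1) * norm w powr (- s))"
      by (intro set_integrable_mult_left set_integrable_Gamma s)
  qed simp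
  then have "norm (cK0 w) \<le> exp (- Re w) * ((LBINT v:{0<..}. exp (- v) * v powr (s - 1)) * norm w powr (- s))"
    unfolding cK0_def norm_mult norm_exp_eq_Re set_integral_mult_left
    by (intro mult_mono) auto
  then show ?thesis by (simp only: mult_ac)
qed

lemma norm_cK0_le_envelope:
  obtains D where "D \<ge> 1"
    "\<And>w. Re w \<ge> 0 \<Longrightarrow> Im w \<ge> 0 \<Longrightarrow> w \<noteq> 0 \<Longrightarrow> norm (cK0 w) \<le> D * exp (- Re w) * envelope (norm w)"
proof -
  define g where "g s = (LBINT v:{0<..}. exp (- v) * v powr (s - 1 :: real))" for s
  define D where "D = max 1 (max (g (1/8)) (g (1/2)))"
  show ?thesis
  proof (rule that[of D])
    fix w :: complex assume w: "Re w \<ge> 0" "Im w \<ge> 0" "w \<noteq> 0"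
    have "norm (cK0 w) \<le> D * exp (- Re w) * norm w powr (- s)" if "s = 1/8 \<or> s = 1/2" for s
    proof -
      have "norm (cK0 w) \<le> g s * exp (- Re w) * norm w powr (- s)"
        unfolding g_def using that by (intro norm_cK0_le_powr w) auto
      also have "\<dots> \<le> D * exp (- Re w) * norm w powr (- s)"
      proof (intro mult_right_mono)
        show "g s \<le> D" using that by (metis D_def max.cobounded1 max.coboundedI2 max.cobounded2)
      qed auto
      finally show ?thesis .
    qed
    from this[of "1/8"] this[of "1/2"]
    show "norm (cK0 w) \<le> D * exp (- Re w) * envelope (norm w)"
      unfolding envelope_def min_def by simp
  qed (simp add: D_def)
qed

section \<open>Values of cK0 on the positive real and imaginary axes\<close>

lemma half_le_sinh:
  assumes "0 \<le> (u::real)"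
  shows "u / 2 \<le> sinh u"
proof -
  have "exp (- u) \<le> 1" using assms by simp
  then have "u \<le> exp u - exp (- u)" using exp_ge_add_one_self[of u] by linarith
  then show ?thesis by (simp add: sinh_field_def)
qed

lemma half_le_cosh: "0 \<le> u \<Longrightarrow> u / 2 \<le> cosh (u::real)"
  using half_le_sinh[of u] sinh_le_cosh_real[of u] by linarith

lemma set_integrable_exp_neg:
  assumes "(c::real) > 0"
  shows "set_integrable lborel {0<..} (\<lambda>u. exp (- (c * (u / 2))))"
  using integrable_I0i_exp_mscale[of "c / 2"] assms by (simp add: mult_ac)

lemma set_integrable_exp_cosh:
  assumes "Re w > 0"
  shows "set_integrable lborel {0<..} (\<lambda>u. exp (- w * of_real (cosh u)))"
proof (rule set_integrable_dominatedI[OF _ _ set_integrable_exp_neg[OF assms]])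
  fix u :: real assume "u \<in> {0<..}"
  then show "norm (exp (- w * of_real (cosh u))) \<le> exp (- (Re w * (u / 2)))"
    using assms half_le_cosh[of u] by simp
qed (auto intro!: continuous_intros)

lemma set_integrable_exp_sinh:
  assumes "Im w > 0"
  shows "set_integrable lborel {0<..} (\<lambda>u. exp (\<i> * w * of_real (sinh u)))"
proof (rule set_integrable_dominatedI[OF _ _ set_integrable_exp_neg[OF assms]])
  fix u :: real assume "u \<in> {0<..}"
  then show "norm (exp (\<i> * w * of_real (sinh u))) \<le> exp (- (Im w * (u / 2)))"
    using assms half_le_sinh[of u] by simp
qed (auto intro!: continuous_intros)

text \<open>The substitution \<open>v = t (cosh u - 1)\<close>, for which
\<open>v (v + 2t) = t\<^sup>2 sinh\<^sup>2 u\<close>.\<close>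

lemma cK0_of_real_conv_cosh_integral:
  assumes t: "t > 0"
  shows "cK0 (of_real t) = (LBINT u:{0<..}. exp (- of_real t * of_real (cosh u)))"
proof -
  define f where "f v = exp (- v) / sqrt v / sqrt (v + 2 * t)" for v
  define g where "g u = t * (cosh u - 1)" for u :: real
  have sub: "f (g u) * (t * sinh u) = exp t * exp (- (t * cosh u))" if "u > 0" for u
  proof -
    have c: "cosh u > 1"
      using cosh_real_nonneg_less_iff[of 0 u] that by simp
    have "sqrt (g u) * sqrt (g u + 2 * t) = sqrt ((t * sinh u)\<^sup>2)"
      unfolding real_sqrt_mult[symmetric] using cosh_square_eq[of u]
      by (simp add: g_def power2_eq_square algebra_simps)
    also have "\<dots> = t * sinh u" using t that by simp
    finally have "f (g u) = exp (- g u) / (t * sinh u)" by (simp add: f_def)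
    then have "f (g u) * (t * sinh u) = exp (- g u)" using t that by simp
    also have "- g u = t + - (t * cosh u)" by (simp add: g_def algebra_simps)
    finally show ?thesis by (simp only: exp_add)
  qed
  have int: "set_integrable lborel {0<..} (\<lambda>u. exp (- (t * cosh u)))"
  proof (rule set_integrable_dominatedI[OF _ _ set_integrable_exp_neg[OF t]])
    fix u :: real assume "u \<in> {0<..}"
    then show "norm (exp (- (t * cosh u))) \<le> exp (- (t * (u / 2)))"
      using t half_le_cosh[of u] by simp
  qed (auto intro!: continuous_intros)
  have gpos: "g u > 0" if "u > 0" for u
    using t cosh_real_nonneg_less_iff[of 0 u] that by (simp add: g_def)
  have "(LBINT v=0..\<infinity>. f v) = (LBINT u=0..\<infinity>. f (g u) * (t * sinh u))"
  proof (rule interval_integral_substitution_nonneg)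
    show "(0::ereal) < \<infinity>" by simp
    fix x assume x: "0 < ereal x" "ereal x < \<infinity>"
    then have x0: "x > 0" by simp
    show "DERIV g x :> t * sinh x" unfolding g_def by (auto intro!: derivative_eq_intros)
    show "isCont f (g x)" unfolding f_def using gpos[OF x0] t by (intro continuous_intros) auto
    show "isCont (\<lambda>u. t * sinh u) x" by (intro continuous_intros)
    show "0 \<le> f (g x)" using gpos[OF x0] t by (simp add: f_def)
  next
    fix x assume "0 \<le> ereal x" "ereal x \<le> \<infinity>"
    then show "0 \<le> t * sinh x" using t by simp
  next
    have "(g \<longlongrightarrow> g 0) (at_right 0)"
      unfolding g_def by (intro tendsto_intros)
    then show "((ereal \<circ> g \<circ> real_of_ereal) \<longlongrightarrow> 0) (at_right 0)"
      by (simp add: zero_ereal_def ereal_tendsto_simps g_def)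
    have "filterlim g at_top at_top"
    proof (rule filterlim_at_top_mono)
      show "filterlim (\<lambda>u. t * (u / 2 - 1)) at_top at_top" using t by real_asymp
      show "\<forall>\<^sub>F u in at_top. t * (u / 2 - 1) \<le> g u"
        using eventually_ge_at_top[of 0]
        by eventually_elim (use t half_le_cosh in \<open>simp add: g_def\<close>)
    qed
    then show "((ereal \<circ> g \<circ> real_of_ereal) \<longlongrightarrow> \<infinity>) (at_left \<infinity>)"
      by (simp add: ereal_tendsto_simps)
    have "set_integrable lborel {0<..} (\<lambda>u. exp t * exp (- (t * cosh u)))"
      using int by simp
    also have "?this \<longleftrightarrow> set_integrable lborel (einterval 0 \<infinity>) (\<lambda>x. f (g x) * (t * sinh x))"
      by (intro set_integrable_cong) (auto simp: einterval_iff sub)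
    finally show "set_integrable lborel (einterval 0 \<infinity>) (\<lambda>x. f (g x) * (t * sinh x))" .
  qed
  then have "(LBINT v:{0<..}. f v) = (LBINT u:{0<..}. f (g u) * (t * sinh u))"
    by (simp add: interval_lebesgue_integral_0_infty)
  also have "\<dots> = (LBINT u:{0<..}. exp t * exp (- (t * cosh u)))"
    by (intro set_lebesgue_integral_cong) (auto simp: sub)
  also have "\<dots> = exp t * (LBINT u:{0<..}. exp (- (t * cosh u)))" by simp
  finally have eq: "(LBINT v:{0<..}. f v) = exp t * (LBINT u:{0<..}. exp (- (t * cosh u)))" .
  have "(LBINT v:{0<..}. of_real (exp (- v) / sqrt v) / csqrt (of_real v + 2 * of_real t))
      = (LBINT v:{0<..}. complex_of_real (f v))"
  proof (intro set_lebesgue_integral_cong allI impI)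
    fix v :: real assume "v \<in> {0<..}"
    moreover have "complex_of_real v + 2 * of_real t = of_real (v + 2 * t)" by simp
    ultimately show "of_real (exp (- v) / sqrt v) / csqrt (of_real v + 2 * of_real t) = complex_of_real (f v)"
      using t by (simp only: csqrt_of_real) (simp add: f_def csqrt_of_real)
  qed simp
  also have "\<dots> = of_real (exp t * (LBINT u:{0<..}. exp (- (t * cosh u))))"
    by (simp only: set_integral_complex_of_real eq)
  finally have "cK0 (of_real t) = exp (- of_real t) * (of_real (exp t) * of_real (LBINT u:{0<..}. exp (- (t * cosh u))))"
    by (simp add: cK0_def)
  also have "\<dots> = of_real (LBINT u:{0<..}. exp (- (t * cosh u)))"
    by (simp flip: exp_of_real mult.assoc exp_add)
  also have "\<dots> = (LBINT u:{0<..}. exp (- of_real t * of_real (cosh u)))"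
    unfolding set_integral_complex_of_real[symmetric] by (simp flip: exp_of_real)
  finally show ?thesis .
qed

lemma cK0_of_real:
  assumes "t > 0"
  shows "cK0 (of_real t) = of_real (bessel_K0 t)"
proof -
  have "cK0 (of_real t) = (LBINT u:{0<..}. complex_of_real (exp (- t * cosh u)))"
    unfolding cK0_of_real_conv_cosh_integral[OF assms] by (simp flip: exp_of_real)
  then show ?thesis
    by (simp only: bessel_K0_def LBINT_atLeast_eq_greaterThan set_integral_complex_of_real)
qed

lemma cosh_integral_holomorphic:
  "(\<lambda>w. LBINT u:{0<..}. exp (- w * of_real (cosh u))) holomorphic_on {w. Re w > 0}"
proof (rule holomorphic_on_set_integral)
  show "open {w. Re w > 0}" by (intro open_Collect_less continuous_intros)
  fix w :: complex assume "w \<in> {w. Re w > 0}"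
  then have w: "Re w > 0" by simp
  show "set_borel_measurable lborel {0<..} (\<lambda>u. exp (- w * of_real (cosh u)))"
    using set_integrable_exp_cosh[OF w] by (auto simp: set_integrable_def set_borel_measurable_def)
  have lower: "Re z > Re w / 2" if "z \<in> ball w (Re w / 2)" for z
    using that complex_Re_le_cmod[of "w - z"] by (simp add: dist_norm)
  show "\<exists>r>0. \<exists>h. ball w r \<subseteq> {w. Re w > 0} \<and> set_integrable lborel {0<..} h \<and>
      (\<forall>z\<in>ball w r. \<forall>u\<in>{0<..}. norm (exp (- z * of_real (cosh u))) \<le> h u)"
  proof (intro exI[of _ "Re w / 2"] exI[of _ "\<lambda>u. exp (- ((Re w / 2) * (u / 2)))"] conjI ballI)
    show "ball w (Re w / 2) \<subseteq> {w. Re w > 0}" using lower w by fastforce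
    show "set_integrable lborel {0<..} (\<lambda>u. exp (- ((Re w / 2) * (u / 2))))"
      using w by (intro set_integrable_exp_neg) simp
    fix z and u :: real assume z: "z \<in> ball w (Re w / 2)" and "u \<in> {0<..}"
    then have "(Re w / 2) * (u / 2) \<le> Re z * cosh u"
      using lower[OF z] w half_le_cosh[of u] by (intro mult_mono) auto
    then show "norm (exp (- z * of_real (cosh u))) \<le> exp (- ((Re w / 2) * (u / 2)))" by simp
  qed (use w in simp)
qed (intro holomorphic_intros)

lemma sinh_integral_holomorphic:
  "(\<lambda>w. LBINT u:{0<..}. exp (\<i> * w * of_real (sinh u))) holomorphic_on {w. Im w > 0}"
proof (rule holomorphic_on_set_integral)
  show "open {w. Im w > 0}" by (intro open_Collect_less continuous_intros)
  fix w :: complex assume "w \<in> {w. Im w > 0}"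
  then have w: "Im w > 0" by simp
  show "set_borel_measurable lborel {0<..} (\<lambda>u. exp (\<i> * w * of_real (sinh u)))"
    using set_integrable_exp_sinh[OF w] by (auto simp: set_integrable_def set_borel_measurable_def)
  have lower: "Im z > Im w / 2" if "z \<in> ball w (Im w / 2)" for z
    using that abs_Im_le_cmod[of "w - z"] by (simp add: dist_norm)
  show "\<exists>r>0. \<exists>h. ball w r \<subseteq> {w. Im w > 0} \<and> set_integrable lborel {0<..} h \<and>
      (\<forall>z\<in>ball w r. \<forall>u\<in>{0<..}. norm (exp (\<i> * z * of_real (sinh u))) \<le> h u)"
  proof (intro exI[of _ "Im w / 2"] exI[of _ "\<lambda>u. exp (- ((Im w / 2) * (u / 2)))"] conjI ballI)
    show "ball w (Im w / 2) \<subseteq> {w. Im w > 0}" using lower w by fastforce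
    show "set_integrable lborel {0<..} (\<lambda>u. exp (- ((Im w / 2) * (u / 2))))"
      using w by (intro set_integrable_exp_neg) simp
    fix z and u :: real assume z: "z \<in> ball w (Im w / 2)" and "u \<in> {0<..}"
    then have "(Im w / 2) * (u / 2) \<le> Im z * sinh u"
      using lower[OF z] w half_le_sinh[of u] by (intro mult_mono) auto
    then show "norm (exp (\<i> * z * of_real (sinh u))) \<le> exp (- ((Im w / 2) * (u / 2)))" by simp
  qed (use w in simp)
qed (intro holomorphic_intros)

lemma cosh_minus_ii:
  "cosh (of_real u - \<i> * of_real \<phi>) = Complex (cosh u * cos \<phi>) (- (sinh u * sin \<phi>))"
  by (simp add: complex_eq_iff cosh_field_def sinh_field_def Re_exp Im_exp exp_minus field_simps)

text \<open>The entire function \<open>exp (- w cosh \<zeta>)\<close> is integrated along the boundary of the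
half-strip between \<open>\<zeta> = u\<close> and \<open>\<zeta> = u - \<i> \<pi>/2\<close>. The lower edge
gives the integral with \<open>sinh\<close>, the short left edge the one with \<open>cos\<close>. The
far edge contributes nothing in the limit because both parts of \<open>w\<close> are positive.\<close>

lemma cosh_integral_shift:
  assumes w: "Re w > 0" "Im w > 0"
  shows "(LBINT u:{0<..}. exp (- w * of_real (cosh u)))
    = - \<i> * (LBINT \<phi>:{0..pi/2}. exp (- w * of_real (cos \<phi>))) + (LBINT u:{0<..}. exp (\<i> * w * of_real (sinh u)))"
proof -
  define f where "f \<zeta> = exp (- w * cosh \<zeta>)" for \<zeta>
  have hol: "f holomorphic_on UNIV" unfolding f_def cosh_field_def by (intro holomorphic_intros) auto
  obtain F where F: "\<And>z. (F has_field_derivative f z) (at z)"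
    using holomorphic_convex_primitive'[OF convex_UNIV open_UNIV hol] by auto
  have cf: "continuous_on UNIV f" using hol by (rule holomorphic_on_imp_continuous_on)
  have f0: "f (of_real u) = exp (- w * of_real (cosh u))" for u
    using cosh_minus_ii[of u 0] by (simp add: f_def Complex_eq)
  have f1: "f (- \<i> * of_real \<phi>) = exp (- w * of_real (cos \<phi>))" for \<phi>
    using cosh_minus_ii[of 0 \<phi>] by (simp add: f_def Complex_eq)
  have f2: "f (- \<i> * of_real (pi / 2) + of_real u) = exp (\<i> * w * of_real (sinh u))" for u
    using cosh_minus_ii[of u "pi / 2"] by (simp add: f_def Complex_eq mult_ac)
  have bottom: "(LBINT u:{0..R}. exp (- w * of_real (cosh u))) = F (of_real R) - F 0" if "R \<ge> 0" for R
    using LBINT_primitive_on_line[OF that, of 0 1 UNIV F f] F cf by (simp add: f0)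
  have top: "(LBINT u:{0..R}. exp (\<i> * w * of_real (sinh u)))
      = F (- \<i> * of_real (pi / 2) + of_real R) - F (- \<i> * of_real (pi / 2))" if "R \<ge> 0" for R
    using LBINT_primitive_on_line[OF that, of "- \<i> * of_real (pi / 2)" 1 UNIV F f] F cf
    by (simp only: f2 mult_1_left UNIV_I simp_thms of_real_0 add_0_right)
  have left: "- \<i> * (LBINT \<phi>:{0..pi/2}. exp (- w * of_real (cos \<phi>))) = F (- \<i> * of_real (pi / 2)) - F 0"
    using LBINT_primitive_on_line[of 0 "pi/2" 0 "- \<i>" UNIV F f] F cf
    by (simp only: f1 add_0_left UNIV_I simp_thms of_real_0 mult_zero_right set_integral_mult_right)
       simp
  define m where "m = min (Re w) (Im w)"
  have m: "m > 0" using w by (simp add: m_def)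
  have right: "norm (F (- \<i> * of_real (pi / 2) + of_real R) - F (of_real R)) \<le> exp (- (m * (R / 2))) * (pi / 2)"
    if R: "R \<ge> 0" for R
  proof -
    have "F (- \<i> * of_real (pi / 2) + of_real R) - F (of_real R) = (LBINT \<phi>:{0..pi/2}. - \<i> * f (of_real R + - \<i> * of_real \<phi>))"
      using LBINT_primitive_on_line[of 0 "pi/2" "of_real R" "- \<i>" UNIV F f] F cf by (simp add: add.commute)
    also have "norm \<dots> \<le> (LBINT \<phi>:{0..pi/2}. exp (- (m * (R / 2))))"
    proof (rule set_integral_dominated_le)
      show "continuous_on {0..pi/2} (\<lambda>\<phi>. - \<i> * f (of_real R + - \<i> * of_real \<phi>))"
        by (intro continuous_intros continuous_on_compose2[OF cf]) auto
      show "set_integrable lborel {0..pi/2} (\<lambda>\<phi>. exp (- (m * (R / 2))))"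
        by (intro set_integrable_interval continuous_intros)
      fix \<phi> :: real assume "\<phi> \<in> {0..pi/2}"
      then have cs: "0 \<le> cos \<phi>" "0 \<le> sin \<phi>" "cos \<phi> \<le> 1" "sin \<phi> \<le> 1"
        by (auto intro!: cos_ge_zero sin_ge_zero)
      have "1 = cos \<phi> * cos \<phi> + sin \<phi> * sin \<phi>" by (simp flip: power2_eq_square)
      also have "\<dots> \<le> cos \<phi> * 1 + sin \<phi> * 1" using cs by (intro add_mono mult_left_mono) auto
      finally have cs1: "1 \<le> cos \<phi> + sin \<phi>" by simp
      have "m * (R / 2) * 1 \<le> m * sinh R * (cos \<phi> + sin \<phi>)"
        using m R half_le_sinh[OF R] cs1 by (intro mult_mono) auto
      also have "\<dots> = m * (sinh R * cos \<phi>) + m * (sinh R * sin \<phi>)" by (simp add: algebra_simps)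
      also have "\<dots> \<le> Re w * (cosh R * cos \<phi>) + Im w * (sinh R * sin \<phi>)"
        using cs R w sinh_le_cosh_real[of R] by (intro add_mono mult_mono) (auto simp: m_def)
      finally have "m * (R / 2) \<le> Re w * (cosh R * cos \<phi>) + Im w * (sinh R * sin \<phi>)" by simp
      then show "norm (- \<i> * f (of_real R + - \<i> * of_real \<phi>)) \<le> exp (- (m * (R / 2)))"
        using cosh_minus_ii[of R \<phi>] by (simp add: f_def norm_mult)
    qed simp
    also have "\<dots> = exp (- (m * (R / 2))) * (pi / 2)" by (simp add: set_integral_const)
    finally show ?thesis .
  qed
  have lim1: "((\<lambda>R. LBINT u:{0..R}. exp (- w * of_real (cosh u))) \<longlongrightarrow> (LBINT u:{0<..}. exp (- w * of_real (cosh u)))) at_top"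
    using tendsto_set_lebesgue_integral_at_top[of 0 lborel "\<lambda>u. exp (- w * of_real (cosh u))"]
      set_integrable_exp_cosh[OF w(1)]
    by (simp add: set_integrable_atLeast_iff_greaterThan LBINT_atLeast_eq_greaterThan)
  have lim2: "((\<lambda>R. LBINT u:{0..R}. exp (\<i> * w * of_real (sinh u))) \<longlongrightarrow> (LBINT u:{0<..}. exp (\<i> * w * of_real (sinh u)))) at_top"
    using tendsto_set_lebesgue_integral_at_top[of 0 lborel "\<lambda>u. exp (\<i> * w * of_real (sinh u))"]
      set_integrable_exp_sinh[OF w(2)]
    by (simp add: set_integrable_atLeast_iff_greaterThan LBINT_atLeast_eq_greaterThan)
  have "((\<lambda>R. F (- \<i> * of_real (pi / 2) + of_real R) - F (of_real R)) \<longlongrightarrow> 0) at_top"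
  proof (rule Lim_null_comparison)
    show "\<forall>\<^sub>F R in at_top. norm (F (- \<i> * of_real (pi / 2) + of_real R) - F (of_real R)) \<le> exp (- (m * (R / 2))) * (pi / 2)"
      using eventually_ge_at_top[of 0] by eventually_elim (rule right)
    show "((\<lambda>R. exp (- (m * (R / 2))) * (pi / 2)) \<longlongrightarrow> 0) at_top" using m by real_asymp
  qed
  moreover have "\<forall>\<^sub>F R in at_top. F (- \<i> * of_real (pi / 2) + of_real R) - F (of_real R)
      = (LBINT u:{0..R}. exp (\<i> * w * of_real (sinh u))) - (LBINT u:{0..R}. exp (- w * of_real (cosh u)))
        + (F (- \<i> * of_real (pi / 2)) - F 0)"
    using eventually_ge_at_top[of 0] by eventually_elim (simp only: top bottom, simp)
  ultimately have "((\<lambda>R. (LBINT u:{0..R}. exp (\<i> * w * of_real (sinh u))) - (LBINT u:{0..R}. exp (- w * of_real (cosh u)))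
        + (F (- \<i> * of_real (pi / 2)) - F 0)) \<longlongrightarrow> 0) at_top"
    by (rule Lim_transform_eventually)
  moreover have "((\<lambda>R. (LBINT u:{0..R}. exp (\<i> * w * of_real (sinh u))) - (LBINT u:{0..R}. exp (- w * of_real (cosh u)))
        + (F (- \<i> * of_real (pi / 2)) - F 0))
      \<longlongrightarrow> (LBINT u:{0<..}. exp (\<i> * w * of_real (sinh u))) - (LBINT u:{0<..}. exp (- w * of_real (cosh u)))
        + (F (- \<i> * of_real (pi / 2)) - F 0)) at_top"
    by (intro tendsto_intros lim1 lim2)
  ultimately have "(LBINT u:{0<..}. exp (\<i> * w * of_real (sinh u))) - (LBINT u:{0<..}. exp (- w * of_real (cosh u)))
        + (F (- \<i> * of_real (pi / 2)) - F 0) = 0"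
    using tendsto_unique trivial_limit_at_top_linorder by blast
  then show ?thesis unfolding left by (simp add: algebra_simps)
qed

text \<open>The formula holds on the positive real axis, and both sides are holomorphic on the intersection of
the two half-planes, which is connected, so the identity theorem extends it.\<close>

lemma cK0_conv_cosh_integral:
  assumes "w \<in> halfplane" "Re w > 0"
  shows "cK0 w = (LBINT u:{0<..}. exp (- w * of_real (cosh u)))"
proof -
  define S where "S = halfplane \<inter> {w. Re w > 0}"
  have "cK0 w - (LBINT u:{0<..}. exp (- w * of_real (cosh u))) = 0"
  proof (rule analytic_continuation[of "\<lambda>w. cK0 w - (LBINT u:{0<..}. exp (- w * of_real (cosh u)))" S "of_real ` {0<..}" 1])
    show "(\<lambda>w. cK0 w - (LBINT u:{0<..}. exp (- w * of_real (cosh u)))) holomorphic_on S"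
      unfolding S_def
      by (intro holomorphic_on_diff holomorphic_on_subset[OF cK0_holomorphic]
            holomorphic_on_subset[OF cosh_integral_holomorphic]) auto
    show "open S" unfolding S_def
      by (intro open_Int open_halfplane open_Collect_less continuous_intros)
    show "connected S" unfolding S_def
      by (intro convex_connected convex_Int convex_halfplane convex_halfspace_Re_gt)
    show "complex_of_real ` {0<..} \<subseteq> S" by (auto simp: S_def)
    have "(1::real) islimpt {0<..}" by (intro interior_limit_point) (simp add: interior_open)
    then obtain X :: "nat \<Rightarrow> real" where X: "\<And>n. X n \<in> {0<..} - {1}" "X \<longlonglongrightarrow> 1"
      unfolding islimpt_sequential by blast
    have "(\<lambda>n. complex_of_real (X n)) \<longlonglongrightarrow> 1" using tendsto_of_real[OF X(2)] by simp
    then show "1 islimpt complex_of_real ` {0<..}"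
      unfolding islimpt_sequential using X(1) by (intro exI[of _ "\<lambda>n. complex_of_real (X n)"]) auto
    show "\<And>z. z \<in> complex_of_real ` {0<..} \<Longrightarrow> cK0 z - (LBINT u:{0<..}. exp (- z * of_real (cosh u))) = 0"
      using cK0_of_real_conv_cosh_integral by auto
  qed (use assms in \<open>auto simp: S_def\<close>)
  then show ?thesis by simp
qed

text \<open>On the open quadrant this combines the two preceding formulas; both sides are holomorphic across the
imaginary axis, so the identity theorem carries it there.\<close>

lemma cK0_conv_sinh_integral:
  assumes "w \<in> halfplane" "Im w > 0"
  shows "cK0 w = - \<i> * (LBINT \<phi>:{0..pi/2}. exp (- w * of_real (cos \<phi>))) + (LBINT u:{0<..}. exp (\<i> * w * of_real (sinh u)))"
proof (rule analytic_continuation_open[of "{w. Re w > 0} \<inter> {w. Im w > 0}" "halfplane \<inter> {w. Im w > 0}" cK0])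
  show "open ({w. Re w > 0} \<inter> {w. Im w > 0})"
    by (intro open_Int open_Collect_less continuous_intros)
  show "open (halfplane \<inter> {w. Im w > 0})"
    by (intro open_Int open_halfplane open_Collect_less continuous_intros)
  have "Complex 1 1 \<in> {w. Re w > 0} \<inter> {w. Im w > 0}" by simp
  then show "{w. Re w > 0} \<inter> {w. Im w > 0} \<noteq> {}" by blast
  show "connected (halfplane \<inter> {w. Im w > 0})"
    by (intro convex_connected convex_Int convex_halfplane convex_halfspace_Im_gt)
  show "cK0 holomorphic_on halfplane \<inter> {w. Im w > 0}"
    by (rule holomorphic_on_subset[OF cK0_holomorphic]) auto
  show "(\<lambda>w. - \<i> * (LBINT \<phi>:{0..pi/2}. exp (- w * of_real (cos \<phi>))) + (LBINT u:{0<..}. exp (\<i> * w * of_real (sinh u))))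
      holomorphic_on halfplane \<inter> {w. Im w > 0}"
  proof (intro holomorphic_intros)
    have "((\<lambda>w. LBINT \<phi>:{0..pi/2}. exp (w * of_real (cos \<phi>))) \<circ> uminus) holomorphic_on UNIV"
      by (intro holomorphic_on_compose holomorphic_on_subset[OF cos_integral_holomorphic] holomorphic_intros) auto
    then show "(\<lambda>w. LBINT \<phi>:{0..pi/2}. exp (- w * of_real (cos \<phi>))) holomorphic_on halfplane \<inter> {w. Im w > 0}"
      unfolding o_def by (rule holomorphic_on_subset) simp
    show "(\<lambda>w. LBINT u:{0<..}. exp (\<i> * w * of_real (sinh u))) holomorphic_on halfplane \<inter> {w. Im w > 0}"
      by (rule holomorphic_on_subset[OF sinh_integral_holomorphic]) auto
  qed
  fix z assume "z \<in> {w. Re w > 0} \<inter> {w. Im w > 0}"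
  then show "cK0 z = - \<i> * (LBINT \<phi>:{0..pi/2}. exp (- z * of_real (cos \<phi>))) + (LBINT u:{0<..}. exp (\<i> * z * of_real (sinh u)))"
    using cK0_conv_cosh_integral[of z] cosh_integral_shift[of z] by simp
qed (use assms in auto)

lemma bessel_J0_conv_quarter_period:
  "bessel_J0 t = 2 / pi * (LBINT \<phi>:{0..pi/2}. cos (t * cos \<phi>))"
proof -
  define g where "g \<phi> = cos (t * cos \<phi>)" for \<phi> :: real
  have cg: "set_integrable lborel {a..b} g" for a b
    unfolding g_def by (intro set_integrable_interval continuous_intros)
  have half: "(LBINT \<phi>:{pi/2..pi}. g \<phi>) = (LBINT \<phi>:{0..pi/2}. g \<phi>)"
    unfolding set_lebesgue_integral_def
    by (subst lborel_integral_real_affine[of "-1" _ pi])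
       (auto intro!: Bochner_Integration.integral_cong simp: g_def split: split_indicator)
  have "set_integrable lborel {0..pi} (\<lambda>\<theta>. exp (\<i> * of_real t * of_real (cos \<theta>)))"
    by (intro set_integrable_interval continuous_intros)
  then have "Re (LBINT \<theta>:{0..pi}. exp (\<i> * of_real t * of_real (cos \<theta>))) = (LBINT \<theta>:{0..pi}. g \<theta>)"
    unfolding set_integrable_def set_lebesgue_integral_def
    by (subst integral_Re[symmetric]) (auto simp: g_def Re_exp)
  moreover have "cI0 (\<i> * of_real t) = (LBINT \<theta>:{0..pi}. exp (\<i> * of_real t * of_real (cos \<theta>))) / pi"
    by (simp add: cI0_def)
  ultimately have "Re (cI0 (\<i> * of_real t)) = (LBINT \<theta>:{0..pi}. g \<theta>) / pi"
    by simp
  then have "bessel_J0 t = (LBINT \<theta>:{0..pi}. g \<theta>) / pi" by (simp add: cI0_ii)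
  also have "(LBINT \<theta>:{0..pi}. g \<theta>) = (LBINT \<theta>:{0..pi/2}. g \<theta>) + (LBINT \<theta>:{pi/2<..pi}. g \<theta>)"
    by (subst set_integral_Un[symmetric])
       (auto intro!: set_integrable_subset[OF cg[of 0 pi]] simp: ivl_disj_un)
  also have "(LBINT \<theta>:{pi/2<..pi}. g \<theta>) = (LBINT \<theta>:{pi/2..pi}. g \<theta>)"
    by (rule set_integral_discrete_difference[where X = "{pi/2}"]) auto
  finally have "bessel_J0 t = 2 / pi * (LBINT \<phi>:{0..pi/2}. g \<phi>)" by (simp add: half)
  then show ?thesis by (simp add: g_def)
qed

text \<open>The reason why \<open>J\<^sub>0\<close> can be traded for \<open>K\<^sub>0\<close>. For
\<open>w = \<i> t\<close> the integral with \<open>sinh\<close> is real, so the imaginary part is minus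
the integral of \<open>cos (t cos \<phi>)\<close> over a quarter period, and that integral is
\<open>\<pi>/2\<close> times \<open>J\<^sub>0(t)\<close>.\<close>

lemma Im_cK0_ii:
  assumes "t > 0"
  shows "Im (cK0 (\<i> * of_real t)) = - (pi / 2) * bessel_J0 t"
proof -
  let ?w = "\<i> * of_real t"
  have "set_integrable lborel {0..pi/2} (\<lambda>\<phi>. exp (- ?w * of_real (cos \<phi>)))"
    by (intro set_integrable_interval continuous_intros)
  then have re: "Re (LBINT \<phi>:{0..pi/2}. exp (- ?w * of_real (cos \<phi>))) = (LBINT \<phi>:{0..pi/2}. cos (t * cos \<phi>))"
    unfolding set_integrable_def set_lebesgue_integral_def
    by (subst integral_Re[symmetric]) (auto simp: Re_exp)
  have "exp (\<i> * ?w * of_real (sinh u)) = complex_of_real (exp (- t * sinh u))" for u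
    by (simp add: exp_of_real[symmetric] flip: mult.assoc)
  then have im: "Im (LBINT u:{0<..}. exp (\<i> * ?w * of_real (sinh u))) = 0"
    by (simp only: set_integral_complex_of_real Im_complex_of_real)
  have "cK0 ?w = - \<i> * (LBINT \<phi>:{0..pi/2}. exp (- ?w * of_real (cos \<phi>))) + (LBINT u:{0<..}. exp (\<i> * ?w * of_real (sinh u)))"
    using assms by (intro cK0_conv_sinh_integral) auto
  then have "Im (cK0 ?w) = - Re (LBINT \<phi>:{0..pi/2}. exp (- ?w * of_real (cos \<phi>)))
      + Im (LBINT u:{0<..}. exp (\<i> * ?w * of_real (sinh u)))"
    by (simp only: plus_complex.simps times_complex.simps) simp
  also have "\<dots> = - (pi / 2) * bessel_J0 t"
    by (simp only: re im bessel_J0_conv_quarter_period) simp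
  finally show ?thesis .
qed

section \<open>The Kluyver density as a Bessel moment\<close>

definition bessel_product :: "real \<Rightarrow> nat \<Rightarrow> nat \<Rightarrow> complex \<Rightarrow> complex" where
  "bessel_product x j l w = w * cI0 (of_real x * w) * cI0 w ^ j * cK0 w ^ l"

lemma bessel_product_holomorphic: "bessel_product x j l holomorphic_on halfplane"
proof -
  have "(\<lambda>w. cI0 (of_real x * w)) holomorphic_on halfplane"
    using holomorphic_on_compose_gen[OF _ cI0_holomorphic, of "\<lambda>w. of_real x * w" halfplane]
    by (auto simp: o_def intro: holomorphic_intros)
  then show ?thesis
    unfolding bessel_product_def[abs_def]
    by (intro holomorphic_intros cK0_holomorphic holomorphic_on_subset[OF cI0_holomorphic]) auto
qed

text \<open>The exponential factors combine to \<open>exp ((x + j - l) Re w)\<close>, which is bounded in the first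
quadrant exactly when \<open>x + j \<le> l\<close>. This inequality is what limits \<open>x\<close>: the
product with \<open>j = 2, l = 3\<close> needs \<open>x \<le> 1\<close>, the one with
\<open>j = 1, l = 4\<close> only \<open>x \<le> 3\<close>.\<close>

lemma bessel_product_bound:
  assumes x: "0 < x" "x + real j \<le> real l" and jl: "j + l = 5"
  obtains C where "\<And>w. Re w \<ge> 0 \<Longrightarrow> Im w \<ge> 0 \<Longrightarrow> w \<noteq> 0 \<Longrightarrow>
      norm (bessel_product x j l w) \<le> C / (1 + (norm w)\<^sup>2)"
proof -
  obtain D where D: "D \<ge> 1"
    "\<And>w. Re w \<ge> 0 \<Longrightarrow> Im w \<ge> 0 \<Longrightarrow> w \<noteq> 0 \<Longrightarrow> norm (cK0 w) \<le> D * exp (- Re w) * envelope (norm w)"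
    using norm_cK0_le_envelope by blast
  define A where "A = 10 * (1 + x powr (-1/2))"
  have A: "A \<ge> 0" by (simp add: A_def)
  show ?thesis
  proof (rule that)
    fix w assume w: "Re w \<ge> 0" "Im w \<ge> 0" "w \<noteq> 0"
    define a r Q where "a = Re w" and "r = norm w" and "Q = envelope r"
    have r: "r > 0" using w by (simp add: r_def)
    have Q: "Q \<ge> 0" by (simp add: Q_def envelope_nonneg)
    have "norm (cI0 (of_real x * w)) \<le> 10 * exp (Re (of_real x * w)) * envelope (norm (of_real x * w))"
      using x w by (intro norm_cI0_le_envelope) auto
    also have "\<dots> = 10 * exp (x * a) * envelope (x * r)" using x by (simp add: a_def r_def norm_mult)
    also have "\<dots> \<le> 10 * exp (x * a) * ((1 + x powr (-1/2)) * Q)"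
      unfolding Q_def using x r by (intro mult_left_mono envelope_scale) auto
    also have "\<dots> = A * exp (x * a) * Q" by (simp add: A_def)
    finally have 1: "norm (cI0 (of_real x * w)) \<le> A * exp (x * a) * Q" .
    have 2: "norm (cI0 w) \<le> 10 * exp a * Q"
      using norm_cI0_le_envelope[of w] w by (simp add: a_def r_def Q_def)
    have 3: "norm (cK0 w) \<le> D * exp (- a) * Q"
      using D(2)[of w] w by (simp add: a_def r_def Q_def)
    have "norm (bessel_product x j l w) = r * norm (cI0 (of_real x * w)) * norm (cI0 w) ^ j * norm (cK0 w) ^ l"
      by (simp add: bessel_product_def r_def norm_mult norm_power)
    also have "\<dots> \<le> r * (A * exp (x * a) * Q) * (10 * exp a * Q) ^ j * (D * exp (- a) * Q) ^ l"
      using 1 2 3 r A Q D(1) by (intro mult_mono power_mono) auto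
    also have "\<dots> = A * 10 ^ j * D ^ l * (r * (Q * Q ^ j * Q ^ l)) * (exp (x * a) * exp a ^ j * exp (- a) ^ l)"
      by (simp add: power_mult_distrib mult_ac)
    also have "Q * Q ^ j * Q ^ l = Q ^ 6"
      using jl by (simp flip: power_add power_Suc)
    also have "exp (x * a) * exp a ^ j * exp (- a) ^ l = exp ((x + real j - real l) * a)"
      by (simp flip: exp_of_nat_mult exp_add add: algebra_simps)
    also have "A * 10 ^ j * D ^ l * (r * Q ^ 6) * exp ((x + real j - real l) * a) \<le> A * 10 ^ j * D ^ l * (2 / (1 + r\<^sup>2)) * 1"
    proof (intro mult_mono)
      have "0 < 1 + r\<^sup>2" by (simp add: add_pos_nonneg)
      then show "r * Q ^ 6 \<le> 2 / (1 + r\<^sup>2)"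
        using envelope_power_6_bound[OF r] by (simp add: Q_def pos_le_divide_eq)
      show "exp ((x + real j - real l) * a) \<le> 1"
        using x w by (simp add: a_def mult_nonpos_nonneg)
    qed (use A D r Q in auto)
    finally show "norm (bessel_product x j l w) \<le> (A * 10 ^ j * D ^ l * 2) / (1 + (norm w)\<^sup>2)"
      by (simp add: r_def)
  qed
qed

lemma bessel_product_of_real:
  "t > 0 \<Longrightarrow> bessel_product x j l (of_real t)
     = of_real (t * bessel_I0 (x * t) * bessel_I0 t ^ j * bessel_K0 t ^ l)"
  using cI0_of_real[of "x * t"] by (simp add: bessel_product_def cI0_of_real cK0_of_real)

lemma set_integrable_bessel_moment:
  assumes "0 < x" "x \<le> 3"
  shows "set_integrable lborel {0<..} (\<lambda>t. x * t * bessel_I0 (x * t) * bessel_I0 t * bessel_K0 t ^ 4)"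
proof -
  obtain C where "\<And>w. Re w \<ge> 0 \<Longrightarrow> Im w \<ge> 0 \<Longrightarrow> w \<noteq> 0 \<Longrightarrow>
      norm (bessel_product x 1 4 w) \<le> C / (1 + (norm w)\<^sup>2)"
    using bessel_product_bound[of x 1 4] assms by auto
  from set_integrable_Re[OF wick_rotation(1)[OF bessel_product_holomorphic this]]
  have "set_integrable lborel {0<..} (\<lambda>t. x * Re (bessel_product x 1 4 (of_real t)))" by simp
  also have "?this \<longleftrightarrow> ?thesis"
    by (intro set_integrable_cong) (auto simp: bessel_product_of_real simp del: of_real_mult of_real_power)
  finally show ?thesis .
qed

text \<open>With \<open>H = J + \<i> Y\<close>, the real parts of \<open>J\<^sup>2 H\<^sup>3\<close>,
\<open>H\<^sup>5\<close> and \<open>J H\<^sup>4\<close> are \<open>J\<^sup>5 - 3 J\<^sup>3 Y\<^sup>2\<close>,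
\<open>J\<^sup>5 - 10 J\<^sup>3 Y\<^sup>2 + 5 J Y\<^sup>4\<close> and
\<open>J\<^sup>5 - 6 J\<^sup>3 Y\<^sup>2 + J Y\<^sup>4\<close>. The coefficients 20, 3 and -15 are, up to
scaling, the only ones for which \<open>Y\<close> cancels.\<close>

lemma Re_fifth_power_combination:
  fixes J :: real and H :: complex
  assumes "Re H = J"
  shows "Re (20 * of_real J ^ 2 * H ^ 3 + 3 * H ^ 5 - 15 * of_real J * H ^ 4) = 8 * J ^ 5"
proof -
  obtain Y where "H = Complex J Y" using assms by (metis complex.collapse)
  then show ?thesis
    by (simp add: eval_nat_numeral algebra_simps)
qed

text \<open>\<open>P\<close> is built so that \<open>Re (\<i> P)\<close> on the imaginary axis is, up to sign, the
integrand of \<open>p\<^sub>5\<close> (without the factor \<open>x\<close>). On the real axis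
\<open>\<kappa> cK0 = (2\<i>/\<pi>) K\<^sub>0\<close> is imaginary, so of the three terms only the one
with the fourth power has a real part. The constant is
\<open>15/8 \<cdot> (2/\<pi>)\<^sup>4 = 30/\<pi>\<^sup>4\<close>.\<close>

lemma kluyver_p5_eq_bessel_moment:
  assumes x: "0 < x" "x \<le> 1"
  shows "kluyver_p5 x = 30 / pi ^ 4 *
    (LBINT t:{0<..}. x * t * bessel_I0 (x * t) * bessel_I0 t * bessel_K0 t ^ 4)"
proof -
  define \<kappa> where "\<kappa> = 2 * \<i> / of_real pi"
  define T where "T = bessel_product x"
  define P where "P w = (20 * \<kappa> ^ 3 * T 2 3 w + 3 * \<kappa> ^ 5 * T 0 5 w - 15 * \<kappa> ^ 4 * T 1 4 w) / 8" for w
  obtain C1 where C1: "\<And>w. Re w \<ge> 0 \<Longrightarrow> Im w \<ge> 0 \<Longrightarrow> w \<noteq> 0 \<Longrightarrow> norm (T 2 3 w) \<le> C1 / (1 + (norm w)\<^sup>2)"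
    using bessel_product_bound[of x 2 3] x by (auto simp: T_def)
  obtain C2 where C2: "\<And>w. Re w \<ge> 0 \<Longrightarrow> Im w \<ge> 0 \<Longrightarrow> w \<noteq> 0 \<Longrightarrow> norm (T 0 5 w) \<le> C2 / (1 + (norm w)\<^sup>2)"
    using bessel_product_bound[of x 0 5] x by (auto simp: T_def)
  obtain C3 where C3: "\<And>w. Re w \<ge> 0 \<Longrightarrow> Im w \<ge> 0 \<Longrightarrow> w \<noteq> 0 \<Longrightarrow> norm (T 1 4 w) \<le> C3 / (1 + (norm w)\<^sup>2)"
    using bessel_product_bound[of x 1 4] x by (auto simp: T_def)
  define C where "C = (norm (20 * \<kappa> ^ 3) * C1 + norm (3 * \<kappa> ^ 5) * C2 + norm (15 * \<kappa> ^ 4) * C3) / 8"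
  have hol: "P holomorphic_on halfplane"
    unfolding P_def T_def by (intro holomorphic_intros bessel_product_holomorphic) auto
  have bound: "norm (P w) \<le> C / (1 + (norm w)\<^sup>2)" if w: "Re w \<ge> 0" "Im w \<ge> 0" "w \<noteq> 0" for w
  proof -
    have "norm (P w) \<le> (norm (20 * \<kappa> ^ 3 * T 2 3 w) + norm (3 * \<kappa> ^ 5 * T 0 5 w) + norm (15 * \<kappa> ^ 4 * T 1 4 w)) / 8"
      using norm_triangle_ineq4[of "20 * \<kappa> ^ 3 * T 2 3 w + 3 * \<kappa> ^ 5 * T 0 5 w" "15 * \<kappa> ^ 4 * T 1 4 w"]
        norm_triangle_ineq[of "20 * \<kappa> ^ 3 * T 2 3 w" "3 * \<kappa> ^ 5 * T 0 5 w"]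
      unfolding P_def norm_divide norm_numeral by (intro divide_right_mono) auto
    also have "\<dots> \<le> (norm (20 * \<kappa> ^ 3) * (C1 / (1 + (norm w)\<^sup>2)) + norm (3 * \<kappa> ^ 5) * (C2 / (1 + (norm w)\<^sup>2))
        + norm (15 * \<kappa> ^ 4) * (C3 / (1 + (norm w)\<^sup>2))) / 8"
      unfolding norm_mult[of _ "T _ _ w"]
      by (intro divide_right_mono add_mono mult_left_mono C1 C2 C3 w) auto
    also have "\<dots> = C / (1 + (norm w)\<^sup>2)"
      unfolding C_def
      by (simp only: times_divide_eq_right add_divide_distrib[symmetric])
         (simp only: divide_divide_eq_left mult.commute)
    finally show ?thesis .
  qed
  note wick = wick_rotation[OF hol bound]
  have \<kappa>_powers: "Re (\<kappa> ^ 3) = 0" "Re (\<kappa> ^ 5) = 0" "Re (\<kappa> ^ 4) = 16 / pi ^ 4" "Im (\<kappa> ^ 4) = 0"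
  proof -
    have \<kappa>: "\<kappa> = \<i> * of_real (2 / pi)" by (simp add: \<kappa>_def)
    show "Re (\<kappa> ^ 3) = 0" "Re (\<kappa> ^ 5) = 0" "Re (\<kappa> ^ 4) = 16 / pi ^ 4" "Im (\<kappa> ^ 4) = 0"
      unfolding \<kappa> power_mult_distrib of_real_power[symmetric]
      by (simp_all add: eval_nat_numeral)
  qed
  have real_axis: "Re (P (of_real t)) = - (30 / pi ^ 4) * (t * bessel_I0 (x * t) * bessel_I0 t * bessel_K0 t ^ 4)"
    if t: "t > 0" for t
    unfolding P_def T_def bessel_product_of_real[OF t]
    by (simp add: \<kappa>_powers del: of_real_mult of_real_power)
  have imag_axis: "Re (\<i> * P (\<i> * of_real t)) = - (t * bessel_J0 (x * t) * bessel_J0 t ^ 5)"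
    if t: "t > 0" for t
  proof -
    define H where "H = \<kappa> * cK0 (\<i> * of_real t)"
    have "Re H = bessel_J0 t" using Im_cK0_ii[OF t] by (simp add: H_def \<kappa>_def)
    note comb = Re_fifth_power_combination[OF this]
    have J: "cI0 (of_real x * (\<i> * of_real t)) = of_real (bessel_J0 (x * t))"
      using cI0_ii[of "x * t"] by (simp add: mult_ac)
    have "\<i> * P (\<i> * of_real t) = of_real (- (t * bessel_J0 (x * t)) / 8)
        * (20 * of_real (bessel_J0 t) ^ 2 * H ^ 3 + 3 * H ^ 5 - 15 * of_real (bessel_J0 t) * H ^ 4)"
      unfolding P_def T_def bessel_product_def J cI0_ii H_def power_mult_distrib
      by (simp add: algebra_simps add_divide_distrib diff_divide_distrib)
    then have "Re (\<i> * P (\<i> * of_real t)) = - (t * bessel_J0 (x * t)) / 8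
        * Re (20 * of_real (bessel_J0 t) ^ 2 * H ^ 3 + 3 * H ^ 5 - 15 * of_real (bessel_J0 t) * H ^ 4)"
      by (simp only: Re_complex_of_real Im_complex_of_real times_complex.simps)
    then show ?thesis unfolding comb by simp
  qed
  have iP: "set_integrable lborel {0<..} (\<lambda>t. \<i> * P (\<i> * of_real t))" using wick(2) by simp
  have "(LBINT t:{0<..}. - (30 / pi ^ 4) * (t * bessel_I0 (x * t) * bessel_I0 t * bessel_K0 t ^ 4))
      = (LBINT t:{0<..}. Re (P (of_real t)))"
    by (intro set_lebesgue_integral_cong allI impI) (simp_all only: real_axis greaterThan_iff sets_lborel, simp)
  also have "\<dots> = Re (LBINT t:{0<..}. P (of_real t))"
    by (rule LINT_Re[OF wick(1)])
  also have "\<dots> = Re (LBINT t:{0<..}. \<i> * P (\<i> * of_real t))"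
    by (rule arg_cong[OF wick(3)])
  also have "\<dots> = (LBINT t:{0<..}. Re (\<i> * P (\<i> * of_real t)))"
    by (rule LINT_Re[OF iP, symmetric])
  also have "\<dots> = (LBINT t:{0<..}. - 1 * (t * bessel_J0 (x * t) * bessel_J0 t ^ 5))"
    by (intro set_lebesgue_integral_cong allI impI) (simp_all only: imag_axis greaterThan_iff sets_lborel, simp_all)
  finally have main: "(LBINT t:{0<..}. t * bessel_J0 (x * t) * bessel_J0 t ^ 5)
      = 30 / pi ^ 4 * (LBINT t:{0<..}. t * bessel_I0 (x * t) * bessel_I0 t * bessel_K0 t ^ 4)"
    unfolding set_integral_mult_right by linarith
  have "kluyver_p5 x = (LBINT t:{0<..}. x * (t * bessel_J0 (x * t) * bessel_J0 t ^ 5))"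
    unfolding kluyver_p5_def LBINT_atLeast_eq_greaterThan by (simp add: mult_ac)
  also have "\<dots> = x * (30 / pi ^ 4 * (LBINT t:{0<..}. t * bessel_I0 (x * t) * bessel_I0 t * bessel_K0 t ^ 4))"
    by (simp only: set_integral_mult_right main)
  also have "\<dots> = 30 / pi ^ 4 * (LBINT t:{0<..}. x * (t * bessel_I0 (x * t) * bessel_I0 t * bessel_K0 t ^ 4))"
    unfolding set_integral_mult_right by simp
  finally show ?thesis by (simp only: mult.assoc)
qed

section \<open>The Maclaurin series\<close>

lemma bessel_I0_nonneg: "bessel_I0 t \<ge> 0"
  unfolding sums_unique[OF bessel_I0_sums[of t]]
  by (intro suminf_nonneg sums_summable[OF bessel_I0_sums]) simp

lemma continuous_on_bessel_I0: "continuous_on S bessel_I0"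
proof -
  have "continuous_on S (\<lambda>t. Re (cI0 (of_real t)))"
    by (intro continuous_intros continuous_on_compose2[OF holomorphic_on_imp_continuous_on[OF cI0_holomorphic]]) auto
  then show ?thesis by (simp add: cI0_of_real)
qed

lemma continuous_on_bessel_K0: "continuous_on {0<..} bessel_K0"
proof -
  have "continuous_on {0<..} (\<lambda>t. Re (cK0 (of_real t)))"
    by (intro continuous_intros continuous_on_compose2[OF holomorphic_on_imp_continuous_on[OF cK0_holomorphic]]) auto
  then show ?thesis by (rule continuous_on_eq) (simp add: cK0_of_real)
qed

lemma r5_nonneg: "r5 k \<ge> 0"
proof -
  have "0 \<le> (LBINT t:{0<..}. bessel_I0 t * bessel_K0 t ^ 4 * t ^ (2 * k + 1))"
    unfolding set_lebesgue_integral_def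
    by (intro integral_nonneg_AE AE_I2) (auto simp: bessel_I0_nonneg split: split_indicator)
  then show ?thesis by (simp add: r5_def)
qed

text \<open>Insert the power series of \<open>I\<^sub>0(xt)\<close> into the moment and integrate term by term.
All terms are nonnegative, so the full integrand dominates the partial sums; it is integrable up to
and including \<open>x = 3\<close>.\<close>

lemma r5_sums:
  assumes x: "0 < x" "x \<le> 3"
  shows "(\<lambda>k. r5 k * x ^ (2 * k + 1)) sums
    (30 / pi ^ 4 * (LBINT t:{0<..}. x * t * bessel_I0 (x * t) * bessel_I0 t * bessel_K0 t ^ 4))"
proof -
  define h where "h t = x * t * bessel_I0 (x * t) * bessel_I0 t * bessel_K0 t ^ 4" for t
  define G where "G t = x * t * bessel_I0 t * bessel_K0 t ^ 4" for t
  define u where "u k t = (x * t / 2) ^ (2 * k) / (fact k)\<^sup>2 * G t" for k t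
  have G: "G t \<ge> 0" if "t > 0" for t using that x by (simp add: G_def bessel_I0_nonneg)
  have u: "u k t \<ge> 0" if "t > 0" for k t using G[OF that] by (simp add: u_def)
  have u_sums: "(\<lambda>k. u k t) sums h t" for t
    using sums_mult2[OF bessel_I0_sums[of "x * t"], of "G t"] by (simp add: u_def h_def G_def mult_ac)
  have partial: "(\<Sum>k\<in>K. u k t) \<le> h t" if "t > 0" "finite K" for K t
    using sum_le_suminf[of "\<lambda>k. u k t" K] u_sums[of t] u that by (auto simp: sums_iff)
  have h_int: "set_integrable lborel {0<..} h"
    using set_integrable_bessel_moment[OF x] by (simp add: h_def[abs_def])
  have u_int: "set_integrable lborel {0<..} (u k)" for k
  proof (rule set_integrable_dominatedI[OF _ _ h_int])
    show "continuous_on {0<..} (u k)"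
      unfolding u_def G_def
      by (intro continuous_intros continuous_on_bessel_I0 continuous_on_bessel_K0) auto
    show "norm (u k t) \<le> h t" if "t \<in> {0<..}" for t
      using partial[of t "{k}"] u[of t k] that by simp
  qed simp
  have "(\<lambda>n. \<integral>t. indicator {0<..} t *\<^sub>R (\<Sum>k<n. u k t) \<partial>lborel) \<longlonglongrightarrow> (\<integral>t. indicator {0<..} t *\<^sub>R h t \<partial>lborel)"
  proof (rule integral_dominated_convergence)
    show "integrable lborel (\<lambda>t. indicator {0<..} t *\<^sub>R h t)" using h_int by (simp add: set_integrable_def)
    then show "(\<lambda>t. indicator {0<..} t *\<^sub>R h t) \<in> borel_measurable lborel" by simp
    have "integrable lborel (\<lambda>t. \<Sum>k<n. indicator {0<..} t *\<^sub>R u k t)" for n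
      using u_int by (intro Bochner_Integration.integrable_sum) (simp add: set_integrable_def)
    then show "(\<lambda>t. indicator {0<..} t *\<^sub>R (\<Sum>k<n. u k t)) \<in> borel_measurable lborel" for n
      unfolding scaleR_sum_right by (rule borel_measurable_integrable)
    show "AE t in lborel. (\<lambda>n. indicator {0<..} t *\<^sub>R (\<Sum>k<n. u k t)) \<longlonglongrightarrow> indicator {0<..} t *\<^sub>R h t"
      using u_sums by (intro AE_I2 tendsto_scaleR tendsto_const) (simp add: sums_def)
    show "AE t in lborel. norm (indicator {0<..} t *\<^sub>R (\<Sum>k<n. u k t)) \<le> indicator {0<..} t *\<^sub>R h t" for n
      using partial[of _ "{..<n}"] u by (intro AE_I2) (auto simp: sum_nonneg split: split_indicator)
  qed
  moreover have "(\<integral>t. indicator {0<..} t *\<^sub>R (\<Sum>k<n. u k t) \<partial>lborel) = (\<Sum>k<n. LBINT t:{0<..}. u k t)" for n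
    unfolding scaleR_sum_right set_lebesgue_integral_def
    using u_int by (intro Bochner_Integration.integral_sum) (simp add: set_integrable_def)
  ultimately have "(\<lambda>k. LBINT t:{0<..}. u k t) sums (LBINT t:{0<..}. h t)"
    by (simp add: sums_def set_lebesgue_integral_def)
  then have "(\<lambda>k. 30 / pi ^ 4 * (LBINT t:{0<..}. u k t)) sums (30 / pi ^ 4 * (LBINT t:{0<..}. h t))"
    by (rule sums_mult)
  moreover have "30 / pi ^ 4 * (LBINT t:{0<..}. u k t) = r5 k * x ^ (2 * k + 1)" for k
  proof -
    have "u k t = x ^ (2 * k + 1) / (4 ^ k * (fact k)\<^sup>2) * (bessel_I0 t * bessel_K0 t ^ 4 * t ^ (2 * k + 1))" for t
      by (simp add: u_def G_def power_mult_distrib power_divide power_mult)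
    then have "(LBINT t:{0<..}. u k t) = x ^ (2 * k + 1) / (4 ^ k * (fact k)\<^sup>2)
        * (LBINT t:{0<..}. bessel_I0 t * bessel_K0 t ^ 4 * t ^ (2 * k + 1))"
      by (simp only: set_integral_mult_right)
    then show ?thesis by (simp add: r5_def mult_ac)
  qed
  ultimately show ?thesis by (simp add: h_def)
qed

theorem theorem3p1:
  "\<exists>f :: real \<Rightarrow> real.
     continuous_on {-3..3} f \<and>
     uniform_limit {-3..3} (\<lambda>n x. \<Sum>k<n. r5 k * x ^ (2 * k + 1)) f sequentially \<and>
     (\<forall>x\<in>{0..1}. f x = kluyver_p5 x)"
proof (intro exI conjI ballI)
  define f where "f x = (\<Sum>k. r5 k * x ^ (2 * k + 1))" for x
  show lim: "uniform_limit {-3..3} (\<lambda>n x. \<Sum>k<n. r5 k * x ^ (2 * k + 1)) f sequentially"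
    unfolding f_def
  proof (rule Weierstrass_m_test)
    show "summable (\<lambda>k. r5 k * 3 ^ (2 * k + 1))"
      using r5_sums[of 3] by (auto simp: sums_iff)
    fix k and x :: real assume "x \<in> {-3..3}"
    then have "\<bar>x\<bar> ^ (2 * k + 1) \<le> 3 ^ (2 * k + 1)" by (intro power_mono) auto
    then show "norm (r5 k * x ^ (2 * k + 1)) \<le> r5 k * 3 ^ (2 * k + 1)"
      using r5_nonneg[of k] by (simp only: real_norm_def abs_mult power_abs abs_of_nonneg mult_left_mono)
  qed
  show "continuous_on {-3..3} f"
    by (rule uniform_limit_theorem[OF _ lim]) (auto intro!: always_eventually continuous_intros)
  fix x :: real assume "x \<in> {0..1}"
  then consider "x = 0" | "0 < x" "x \<le> 1" by fastforce
  then show "f x = kluyver_p5 x"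
  proof cases
    case 1
    then show ?thesis by (simp add: f_def kluyver_p5_def)
  next
    case 2
    then show ?thesis
      using sums_unique[OF r5_sums[of x]] kluyver_p5_eq_bessel_moment[of x] by (simp add: f_def)
  qed
qed

end
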